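(* Let $l\ge1$, $b\ge1$ and $p_1,\dots,p_l\ge1$ be fixed integers, let $c>0$ be fixed, and let $a=cm+b$. For $\pi=(\pi_1,\dots,\pi_m)$ chosen uniformly at random from $\mathrm{PF}(a,b,m)$, as $m\to\infty$, $$\mathbb E\left(\prod_{i=1}^l\pi_i^{p_i}\right)=\frac{((b+c)m)^{\sum_{i=1}^lp_i}}{\prod_{i=1}^l(p_i+1)}\left(1+\frac{1}{c(b+c)m}\left(\frac{c\left(\sum_{i=1}^lp_i+l\right)}{2}-b^2\sum_{i=1}^lp_i\right)+O\left(\frac1{m^2}\right)\right).$$
   Context: $\mathrm{PF}(a,b,m)$, for positive integers $a,b,m$, is the set of $(a,b)$-parking functions of length $m$: sequences $(\pi_1,\dots,\pi_m)$ of positive integers whose non-decreasing rearrangement $(\lambda_1,\dots,\lambda_m)$ satisfies $\lambda_i\le a+(i-1)b$ for all $1\le i\le m$. Since $a=cm+b$ must be a positive integer, $m\to\infty$ runs through values for which $cm$ is an integer. Implied constants may depend on $b,c,l,p_1,\dots,p_l$. *)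

theory Defs
  imports "HOL-Probability.Probability" "HOL-Library.Landau_Symbols"
begin

(* Lists are indexed from 0: the entry pi_i (1 <= i <= m) of a sequence is xs ! (i - 1).
   The non-decreasing rearrangement is sort xs. *)
definition PF :: "nat \<Rightarrow> nat \<Rightarrow> nat \<Rightarrow> nat list set" where
  "PF a b m = {xs. length xs = m \<and> (\<forall>x\<in>set xs. 1 \<le> x) \<and>
     (\<forall>i\<in>{1..m}. sort xs ! (i - 1) \<le> a + (i - 1) * b)}"

(* pmf_of_set is the uniform distribution only on a finite non-empty set;
   finite_PF and PF_nonempty discharge this for a >= 1. *)
definition PF_expectation :: "nat \<Rightarrow> nat \<Rightarrow> nat \<Rightarrow> (nat list \<Rightarrow> real) \<Rightarrow> real" where
  "PF_expectation a b m f = measure_pmf.expectation (pmf_of_set (PF a b m)) f"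

(* "m tends to infinity through the values for which c * m is an integer".
   For irrational c this is the trivial filter bot. *)
definition at_top_int_mult :: "real \<Rightarrow> nat filter" where
  "at_top_int_mult c = inf at_top (principal {m. c * real m \<in> \<int>})"

lemma finite_PF: "finite (PF a b m)"
proof (rule finite_subset)
  show "PF a b m \<subseteq> {xs. set xs \<subseteq> {..a + m * b} \<and> length xs = m}"
  proof (clarsimp simp: PF_def)
    fix xs :: "nat list" and x
    assume *: "\<forall>i\<in>{Suc 0..length xs}.
        sort xs ! (i - Suc 0) \<le> a + (i - Suc 0) * b" and x: "x \<in> set xs"
    from x obtain i where i: "i < length xs" "sort xs ! i = x"
      by (metis in_set_conv_nth length_sort set_sort)
    with *[rule_format, of "Suc i"] have "x \<le> a + i * b" by simp
    also have "\<dots> \<le> a + length xs * b" using i by simp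
    finally show "x \<le> a + length xs * b" .
  qed
  show "finite {xs. set xs \<subseteq> {..a + m * b} \<and> length xs = m}"
    by (rule finite_lists_length_eq) simp
qed

lemma PF_nonempty:
  assumes "1 \<le> a"
  shows "PF a b m \<noteq> {}"
proof -
  have "sort (replicate m (1::nat)) = replicate m 1"
    by (rule sorted_sort_id) (simp add: sorted_replicate)
  then have "replicate m 1 \<in> PF a b m"
    using assms by (auto simp: PF_def)
  then show ?thesis by blast
qed

end

theory Submission
  imports Defs
begin

text \<open>Put \<open>N = a + m * b\<close>. A word over \<open>{1..N}\<close> is a parking function iff for every \<open>s \<ge> 1\<close>
  fewer than \<open>s\<close> of its letters lie among the top \<open>s * b\<close> values. This condition does not mention
  \<open>a\<close> or \<open>m\<close>, so one may append letters while \<open>N\<close> stays fixed.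

  Peeling off the smallest letter gives the number of parking words of length \<open>n\<close> as
  \<open>N ^ n - b * n * N ^ (n - 1)\<close> (lemma \<open>card_parking_words_expanded\<close>).

  Split a parking word into its first \<open>l\<close> letters and the remaining word \<open>vs\<close> of length
  \<open>n = m - l\<close>, which itself parks. Call a letter a spoiler of \<open>vs\<close> if \<open>vs\<close> no longer parks once
  the letter is added. The spoilers form a final segment of \<open>{1..N}\<close>, so \<open>1 - j / N\<close> is small
  for each spoiler \<open>j\<close> unless there are many of them. None of the first \<open>l\<close> letters may be a
  spoiler; conversely, almost all choices of \<open>l\<close> non-spoilers are admissible. Hence the sum of
  \<open>(j_1 / N) ^ p_1 * ... * (j_l / N) ^ p_l\<close> over the admissible prefixes is nearly a product of
  \<open>l\<close> one-letter sums, each lacking about \<open>\<beta>\<close> terms of size 1, where \<open>\<beta>\<close> is the number of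
  spoilers. Expanding the product leaves a term linear in \<open>\<beta>\<close> and an error of order \<open>\<beta> ^ 2\<close>.

  Two facts about \<open>\<beta>\<close> finish the count. Its sum over all parking \<open>vs\<close> is exactly \<open>b * N ^ n\<close>, since
  it compares two parking counts (\<open>spoilers_first_moment\<close>). The sum of its square is \<open>O(N ^ n)\<close>
  (\<open>spoilers_second_moment\<close>): a spoiler at distance \<open>d\<close> from the top needs about \<open>d / b\<close> letters
  of \<open>vs\<close> within that distance, which is exponentially unlikely because the average number of
  letters per block of \<open>b\<close> values is at most \<open>b / (b + c) < 1\<close>. The exactness of the first moment
  also makes the number of wrongly admitted prefixes a second-moment error. With \<open>\<sigma>_i\<close> the mean
  of \<open>(j / N) ^ p_i\<close> over \<open>{1..N}\<close>, the expectation divided by the power of \<open>N\<close> is therefore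
  \<open>(1 + l * b / a) * \<Prod> \<sigma>_i - b / a * (\<Sum>i. \<Prod>k\<noteq>i. \<sigma>_k) + O(1 / (a * N))\<close>
  (\<open>PF_moment_expansion\<close>). The trapezoidal rule gives \<open>\<sigma>_i = 1 / (p_i + 1) + 1 / (2 * N) + O(1 / N ^ 2)\<close>,
  and inserting \<open>a = c * m + b\<close> and \<open>N = (b + c) * m + b\<close> yields the claim to first order in \<open>1 / m\<close>.\<close>

section \<open>Sums over words\<close>

definition words :: "'a set \<Rightarrow> nat \<Rightarrow> 'a list set" where
  "words A n = {xs. set xs \<subseteq> A \<and> length xs = n}"

lemma finite_words [simp]: "finite A \<Longrightarrow> finite (words A n)"
  unfolding words_def by (rule finite_lists_length_eq)

lemma words_0 [simp]: "words A 0 = {[]}"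
  by (auto simp: words_def)

lemma card_words: "finite A \<Longrightarrow> card (words A n) = card A ^ n"
  unfolding words_def by (rule card_lists_length_eq)

lemma sum_words_Suc:
  "(\<Sum>xs\<in>words A (Suc n). f xs) = (\<Sum>x\<in>A. \<Sum>xs\<in>words A n. f (x # xs))"
proof -
  have "(\<Sum>xs\<in>words A (Suc n). f xs) = (\<Sum>(x, xs)\<in>A \<times> words A n. f (x # xs))"
    by (rule sum.reindex_bij_witness[of _ "\<lambda>(x, xs). x # xs" "\<lambda>xs. (hd xs, tl xs)"])
       (auto simp: words_def length_Suc_conv)
  then show ?thesis by (simp add: sum.cartesian_product)
qed

lemma sum_words_append:
  "(\<Sum>xs\<in>words A (k + n). f xs) = (\<Sum>us\<in>words A k. \<Sum>vs\<in>words A n. f (us @ vs))"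
proof -
  have "(\<Sum>xs\<in>words A (k + n). f xs) = (\<Sum>(us, vs)\<in>words A k \<times> words A n. f (us @ vs))"
    by (rule sum.reindex_bij_witness[of _ "\<lambda>(us, vs). us @ vs" "\<lambda>xs. (take k xs, drop k xs)"])
       (auto simp: words_def dest: in_set_takeD in_set_dropD)
  then show ?thesis by (simp add: sum.cartesian_product)
qed

lemma sum_words_prod:
  fixes f :: "nat \<Rightarrow> 'a \<Rightarrow> real"
  shows "(\<Sum>xs\<in>words A n. \<Prod>i<n. f i (xs ! i)) = (\<Prod>i<n. \<Sum>x\<in>A. f i x)"
proof (induction n arbitrary: f)
  case (Suc n)
  have "(\<Sum>xs\<in>words A (Suc n). \<Prod>i<Suc n. f i (xs ! i)) =
        (\<Sum>x\<in>A. f 0 x * (\<Sum>xs\<in>words A n. \<Prod>i<n. f (Suc i) (xs ! i)))"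
    by (simp add: sum_words_Suc prod.lessThan_Suc_shift sum_distrib_left del: prod.lessThan_Suc)
  also have "\<dots> = (\<Prod>i<Suc n. \<Sum>x\<in>A. f i x)"
    by (simp add: Suc.IH[of "\<lambda>i. f (Suc i)"] prod.lessThan_Suc_shift sum_distrib_right
             del: prod.lessThan_Suc)
  finally show ?case .
qed simp

lemma sum_words_power_size_filter:
  fixes z :: real
  shows "finite A \<Longrightarrow> (\<Sum>xs\<in>words A n. z ^ size (filter_mset P (mset xs))) =
         (\<Sum>x\<in>A. if P x then z else 1) ^ n"
proof (induction n)
  case (Suc n)
  have "(\<Sum>xs\<in>words A (Suc n). z ^ size (filter_mset P (mset xs))) =
        (\<Sum>x\<in>A. (if P x then z else 1) * (\<Sum>xs\<in>words A n. z ^ size (filter_mset P (mset xs))))"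
    unfolding sum_words_Suc by (intro sum.cong refl) (simp add: sum_distrib_left)
  then show ?case using Suc by (simp add: sum_distrib_right)
qed simp

text \<open>A summand that depends only on the multiset of letters sees of the letter \<open>v\<close> only its
  multiplicity \<open>k\<close>, and the binomial coefficient counts the positions that \<open>v\<close> can occupy.
  The induction step is Pascal's rule.\<close>

lemma sum_words_insert:
  fixes f :: "'a multiset \<Rightarrow> real"
  assumes "finite A" "v \<notin> A"
  shows "(\<Sum>xs\<in>words (insert v A) n. f (mset xs)) =
         (\<Sum>k\<le>n. real (n choose k) * (\<Sum>xs\<in>words A (n - k). f (replicate_mset k v + mset xs)))"
proof (induction n arbitrary: f)
  case (Suc n)
  define s where "s k = (\<Sum>xs\<in>words A (Suc n - k). f (replicate_mset k v + mset xs))" for k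
  have 1: "(\<Sum>xs\<in>words (insert v A) n. f (add_mset v (mset xs))) =
            (\<Sum>k\<le>n. real (n choose k) * s (Suc k))"
    by (subst Suc.IH[of "\<lambda>M. f (add_mset v M)"]) (simp add: s_def)
  have 2: "(\<Sum>x\<in>A. \<Sum>xs\<in>words (insert v A) n. f (add_mset x (mset xs))) =
            (\<Sum>k\<le>n. real (n choose k) * s k)"
  proof -
    have "(\<Sum>x\<in>A. \<Sum>xs\<in>words (insert v A) n. f (add_mset x (mset xs))) =
          (\<Sum>k\<le>n. real (n choose k) *
             (\<Sum>x\<in>A. \<Sum>xs\<in>words A (n - k). f (replicate_mset k v + mset (x # xs))))"
      by (subst Suc.IH[of "\<lambda>M. f (add_mset x M)" for x], subst sum.swap)
         (simp add: sum_distrib_left)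
    also have "\<dots> = (\<Sum>k\<le>n. real (n choose k) * s k)"
      unfolding s_def by (intro sum.cong refl) (simp add: Suc_diff_le sum_words_Suc)
    finally show ?thesis .
  qed
  have "(\<Sum>xs\<in>words (insert v A) (Suc n). f (mset xs)) =
          (\<Sum>k\<le>n. real (n choose k) * s (Suc k)) + (\<Sum>k\<le>n. real (n choose k) * s k)"
    using assms by (simp add: sum_words_Suc 1 2)
  also have "(\<Sum>k\<le>n. real (n choose k) * s k) = (\<Sum>k\<le>Suc n. real (n choose k) * s k)"
    by simp
  also have "\<dots> = s 0 + (\<Sum>k\<le>n. real (n choose Suc k) * s (Suc k))"
    by (simp add: sum.atMost_Suc_shift del: sum.atMost_Suc)
  also have "(\<Sum>k\<le>n. real (n choose k) * s (Suc k)) +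
       (s 0 + (\<Sum>k\<le>n. real (n choose Suc k) * s (Suc k))) =
       (\<Sum>k\<le>Suc n. real (Suc n choose k) * s k)"
    by (simp add: sum.atMost_Suc_shift sum.distrib algebra_simps del: sum.atMost_Suc)
  finally show ?case by (simp add: s_def)
qed simp

section \<open>Parking words and their number\<close>

text \<open>The parking condition is read from the top of the alphabet \<open>{1..N}\<close>, so that for fixed \<open>N\<close> it
  depends neither on the word length nor on \<open>a\<close>. The addition \<open>x + s * b\<close> avoids truncated
  subtraction when \<open>s * b\<close> exceeds \<open>N\<close>.\<close>

definition top_count :: "nat \<Rightarrow> nat \<Rightarrow> nat \<Rightarrow> nat multiset \<Rightarrow> nat" where
  "top_count N b s M = size (filter_mset (\<lambda>x. N < x + s * b) M)"

definition parks :: "nat \<Rightarrow> nat \<Rightarrow> nat multiset \<Rightarrow> bool" where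
  "parks N b M \<longleftrightarrow> (\<forall>s\<ge>1. top_count N b s M < s)"

lemma top_count_union [simp]:
  "top_count N b s (U + M) = top_count N b s U + top_count N b s M"
  by (simp add: top_count_def)

lemma top_count_add_mset [simp]:
  "top_count N b s (add_mset x M) = of_bool (N < x + s * b) + top_count N b s M"
  by (simp add: top_count_def)

lemma top_count_eq_0_iff: "top_count N b s M = 0 \<longleftrightarrow> (\<forall>x\<in>#M. x + s * b \<le> N)"
  by (induction M) (auto simp: top_count_def)

lemma top_count_le_size: "top_count N b s M \<le> size M"
  unfolding top_count_def by (rule size_filter_mset_lesseq)

lemma parks_unionD: "parks N b (U + M) \<Longrightarrow> parks N b M"
  unfolding parks_def by (auto intro: le_less_trans)

lemma parks_add_msetD: "parks N b (add_mset x M) \<Longrightarrow> parks N b M"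
  using parks_unionD[of N b "{#x#}" M] by simp

lemma sorted_nth_le_iff:
  fixes ys :: "'a::linorder list"
  assumes "sorted ys" "i < length ys"
  shows "ys ! i \<le> v \<longleftrightarrow> length (filter (\<lambda>x. v < x) ys) < length ys - i"
proof
  assume le: "ys ! i \<le> v"
  have "filter (\<lambda>x. v < x) (take (Suc i) ys) = []"
  proof (clarsimp simp: filter_empty_conv in_set_conv_nth)
    fix j assume "j < Suc i" "v < ys ! j"
    then have "ys ! j \<le> ys ! i" using assms by (intro sorted_nth_mono) auto
    with \<open>v < ys ! j\<close> le show False by simp
  qed
  then have "filter (\<lambda>x. v < x) ys = filter (\<lambda>x. v < x) (drop (Suc i) ys)"
    by (metis append_take_drop_id append_Nil filter_append)
  also have "length \<dots> \<le> length (drop (Suc i) ys)" by (rule length_filter_le)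
  also have "\<dots> < length ys - i" using assms by simp
  finally show "length (filter (\<lambda>x. v < x) ys) < length ys - i" .
next
  assume less: "length (filter (\<lambda>x. v < x) ys) < length ys - i"
  show "ys ! i \<le> v"
  proof (rule ccontr)
    assume gt: "\<not> ys ! i \<le> v"
    have "filter (\<lambda>x. v < x) (drop i ys) = drop i ys"
    proof (clarsimp simp: filter_id_conv in_set_conv_nth)
      fix j assume "j < length ys - i"
      then have "ys ! i \<le> ys ! (i + j)" using assms by (intro sorted_nth_mono) auto
      with gt show "v < ys ! (i + j)" by simp
    qed
    then have "length ys - i \<le> length (filter (\<lambda>x. v < x) ys)"
      by (metis append_take_drop_id filter_append length_append length_drop le_add2)
    with less show False by simp
  qed
qed

text \<open>The bound on the \<open>i\<close>-th smallest entry says that at most \<open>m - i\<close> entries exceed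
  \<open>a + (i - 1) * b = N - s * b\<close>, where \<open>s = m - i + 1\<close>. For \<open>s > m\<close> the parking condition is
  vacuous, and for \<open>s = 1\<close> it already bounds all entries by \<open>N\<close>.\<close>

lemma PF_eq_parking_words:
  "PF a b m = {xs \<in> words {1..a + m * b} m. parks (a + m * b) b (mset xs)}"
proof (intro set_eqI)
  fix xs :: "nat list"
  define N where "N = a + m * b"
  have entry: "sort xs ! (i - 1) \<le> a + (i - 1) * b \<longleftrightarrow> top_count N b (m - (i - 1)) (mset xs) < m - (i - 1)"
    if len: "length xs = m" and i: "i \<in> {1..m}" for i
  proof -
    have "sort xs ! (i - 1) \<le> a + (i - 1) * b \<longleftrightarrow>
          length (filter (\<lambda>x. a + (i - 1) * b < x) (sort xs)) < length (sort xs) - (i - 1)"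
      using len i by (intro sorted_nth_le_iff) auto
    also have "length (filter (\<lambda>x. a + (i - 1) * b < x) (sort xs)) =
        size (filter_mset (\<lambda>x. a + (i - 1) * b < x) (mset xs))"
      by (metis mset_filter mset_sort size_mset)
    also have "(\<lambda>x. a + (i - 1) * b < x) = (\<lambda>x. N < x + (m - (i - 1)) * b)"
    proof -
      have "m * b = (i - 1) * b + (m - (i - 1)) * b"
        using i by (simp flip: add_mult_distrib)
      then show ?thesis unfolding N_def by (simp add: fun_eq_iff)
    qed
    finally show ?thesis using len by (simp add: top_count_def)
  qed
  have parks_iff: "(\<forall>i\<in>{1..m}. sort xs ! (i - 1) \<le> a + (i - 1) * b) \<longleftrightarrow> parks N b (mset xs)"
    if len: "length xs = m"
  proof
    assume L: "\<forall>i\<in>{1..m}. sort xs ! (i - 1) \<le> a + (i - 1) * b"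
    show "parks N b (mset xs)" unfolding parks_def
    proof (intro allI impI)
      fix s :: nat assume s: "1 \<le> s"
      show "top_count N b s (mset xs) < s"
      proof (cases "s \<le> m")
        case True
        then have i: "m - s + 1 \<in> {1..m}" using s by auto
        from entry[OF len i] L[rule_format, OF i] True s show ?thesis by simp
      next
        case False
        then show ?thesis using top_count_le_size[of N b s "mset xs"] len by simp
      qed
    qed
  next
    assume P: "parks N b (mset xs)"
    show "\<forall>i\<in>{1..m}. sort xs ! (i - 1) \<le> a + (i - 1) * b"
    proof
      fix i assume i: "i \<in> {1..m}"
      then have "1 \<le> m - (i - 1)" by auto
      with P have "top_count N b (m - (i - 1)) (mset xs) < m - (i - 1)"
        unfolding parks_def by blast
      with entry[OF len i] show "sort xs ! (i - 1) \<le> a + (i - 1) * b" by blast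
    qed
  qed
  have bound: "x \<le> N" if "parks N b (mset xs)" "x \<in> set xs" for x
  proof -
    from that(1) have "top_count N b 1 (mset xs) < 1" unfolding parks_def by blast
    then have "top_count N b 1 (mset xs) = 0" by simp
    with that(2) show ?thesis by (auto simp: top_count_eq_0_iff)
  qed
  show "xs \<in> PF a b m \<longleftrightarrow> xs \<in> {xs \<in> words {1..a + m * b} m. parks (a + m * b) b (mset xs)}"
    using parks_iff bound unfolding N_def[symmetric] PF_def words_def
    by (auto simp: subset_iff Ball_def)
qed

lemma sum_binomial_shift:
  "(\<Sum>k\<le>n. real (n choose k) * (x ^ (n - k) - y * real (n - k) * x ^ (n - k - 1))) =
   (x + 1) ^ n - y * real n * (x + 1) ^ (n - 1)"
proof -
  have bin: "(\<Sum>k\<le>j. real (j choose k) * x ^ (j - k)) = (x + 1) ^ j" for j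
    by (subst add.commute, subst binomial_ring) simp
  have "(\<Sum>k\<le>n. real (n choose k) * real (n - k) * x ^ (n - k - 1)) = real n * (x + 1) ^ (n - 1)"
  proof (cases n)
    case (Suc j)
    have "(\<Sum>k\<le>n. real (n choose k) * real (n - k) * x ^ (n - k - 1)) =
          (\<Sum>k\<le>j. real (n choose k) * real (n - k) * x ^ (n - k - 1))"
      by (simp add: Suc)
    also have "\<dots> = (\<Sum>k\<le>j. real n * (real (j choose k) * x ^ (j - k)))"
    proof (intro sum.cong refl)
      fix k assume "k \<in> {..j}"
      then have "(n choose k) * (n - k) = n * (j choose k)"
        using binomial_absorb_comp[of n k] by (simp add: Suc mult.commute)
      then have "real (n choose k) * real (n - k) = real n * real (j choose k)"
        by (metis of_nat_mult)
      then show "real (n choose k) * real (n - k) * x ^ (n - k - 1) =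
                 real n * (real (j choose k) * x ^ (j - k))"
        by (simp add: Suc)
    qed
    finally show ?thesis by (simp add: Suc bin flip: sum_distrib_left)
  qed simp
  then have "(\<Sum>k\<le>n. y * (real (n choose k) * real (n - k) * x ^ (n - k - 1))) =
             y * (real n * (x + 1) ^ (n - 1))"
    by (simp flip: sum_distrib_left)
  moreover have "(\<Sum>k\<le>n. real (n choose k) * (x ^ (n - k) - y * real (n - k) * x ^ (n - k - 1))) =
      (\<Sum>k\<le>n. real (n choose k) * x ^ (n - k)) -
      (\<Sum>k\<le>n. y * (real (n choose k) * real (n - k) * x ^ (n - k - 1)))"
    unfolding sum_subtractf[symmetric]
    by (intro sum.cong refl) (simp only: right_diff_distrib mult.assoc mult.left_commute)
  ultimately show ?thesis by (simp only: bin mult.assoc)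
qed

text \<open>Induction on the number \<open>K\<close> of letters, adding a new smallest letter \<open>N - K\<close>. If \<open>n * b \<le> K\<close>, that
  letter never lies in the top \<open>s * b\<close> values for \<open>s \<le> n\<close>, so its occurrences are harmless and the
  binomial sum of the previous counts gives the next one. In the boundary case \<open>n * b = K + 1\<close> all
  \<open>n\<close> letters lie among the top \<open>n * b\<close> values, so no word parks, in agreement with the formula.\<close>

lemma card_parking_words_over_top_letters:
  assumes "K \<le> N" "n * b \<le> K"
  shows "(\<Sum>xs\<in>words {N - K<..N} n. of_bool (parks N b (mset xs)) :: real) =
         real K ^ n - real b * real n * real K ^ (n - 1)"
  using assms
proof (induction K arbitrary: n)
  case 0
  show ?case
  proof (cases n)
    case 0
    then show ?thesis by (simp add: parks_def top_count_def)
  next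
    case (Suc k)
    then have "b = 0" using 0 by auto
    have "words {N<..N} n = {}" using Suc by (auto simp: words_def)
    with Suc \<open>b = 0\<close> show ?thesis by simp
  qed
next
  case (Suc K)
  have letters: "{N - Suc K<..N} = insert (N - K) {N - K<..N}"
    using Suc.prems(1) by auto
  show ?case
  proof (cases "n * b \<le> K")
    case True
    have "(\<Sum>xs\<in>words {N - Suc K<..N} n. of_bool (parks N b (mset xs)) :: real) =
          (\<Sum>k\<le>n. real (n choose k) * (\<Sum>xs\<in>words {N - K<..N} (n - k).
              of_bool (parks N b (replicate_mset k (N - K) + mset xs))))"
      unfolding letters by (subst sum_words_insert[where f = "\<lambda>M. of_bool (parks N b M)"]) auto
    also have "\<dots> = (\<Sum>k\<le>n. real (n choose k) * (\<Sum>xs\<in>words {N - K<..N} (n - k).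
              of_bool (parks N b (mset xs))))"
    proof (intro sum.cong refl arg_cong2[where f = "(*)"])
      fix k xs assume k: "k \<in> {..n}" and xs: "xs \<in> words {N - K<..N} (n - k)"
      let ?M = "replicate_mset k (N - K) + mset xs"
      have size: "size ?M = n" using k xs by (simp add: words_def)
      have "parks N b ?M \<longleftrightarrow> parks N b (mset xs)"
      proof
        assume P: "parks N b (mset xs)"
        show "parks N b ?M" unfolding parks_def
        proof (intro allI impI)
          fix s :: nat assume s: "1 \<le> s"
          show "top_count N b s ?M < s"
          proof (cases "s \<le> n")
            case True
            then have "s * b \<le> K" using \<open>n * b \<le> K\<close> by (meson le_trans mult_le_mono1)
            then have "\<not> N < N - K + s * b" using Suc.prems(1) by simp
            then have "top_count N b s (replicate_mset k (N - K)) = 0"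
              by (auto simp: top_count_eq_0_iff)
            with P s show ?thesis by (simp add: parks_def)
          next
            case False
            then show ?thesis using top_count_le_size[of N b s ?M] size by simp
          qed
        qed
      qed (rule parks_unionD)
      then show "(of_bool (parks N b ?M) :: real) = of_bool (parks N b (mset xs))" by simp
    qed
    also have "\<dots> = (\<Sum>k\<le>n. real (n choose k) *
        (real K ^ (n - k) - real b * real (n - k) * real K ^ (n - k - 1)))"
    proof (intro sum.cong refl arg_cong2[where f = "(*)"] Suc.IH)
      fix k show "(n - k) * b \<le> K" using True by (meson diff_le_self le_trans mult_le_mono1)
    qed (use Suc.prems in simp)
    also have "\<dots> = real (Suc K) ^ n - real b * real n * real (Suc K) ^ (n - 1)"
      by (subst sum_binomial_shift) (simp add: add.commute)
    finally show ?thesis .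
  next
    case False
    with Suc.prems have eq: "n * b = Suc K" by simp
    then have n: "1 \<le> n" by (cases n) auto
    have "\<not> parks N b (mset xs)" if "xs \<in> words {N - Suc K<..N} n" for xs
    proof -
      have "filter_mset (\<lambda>x. N < x + n * b) (mset xs) = mset xs"
        using that eq Suc.prems(1) by (auto simp: filter_mset_eq_conv words_def subset_iff)
      then have "top_count N b n (mset xs) = n" using that by (simp add: top_count_def words_def)
      then show ?thesis using n by (auto simp: parks_def)
    qed
    then have "(\<Sum>xs\<in>words {N - Suc K<..N} n. of_bool (parks N b (mset xs)) :: real) = 0"
      by (simp add: sum.neutral)
    also have "0 = real (Suc K) ^ n - real b * real n * real (Suc K) ^ (n - 1)"
    proof -
      obtain k where "n = Suc k" using n by (cases n) auto
      moreover have "real b * real n = real (Suc K)" by (metis eq mult.commute of_nat_mult)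
      ultimately show ?thesis by simp
    qed
    finally show ?thesis .
  qed
qed

lemma card_parking_words_expanded:
  assumes "n * b \<le> N"
  shows "(\<Sum>xs\<in>words {1..N} n. of_bool (parks N b (mset xs)) :: real) =
         real N ^ n - real b * real n * real N ^ (n - 1)"
proof -
  have "{1..N} = {N - N<..N}" by auto
  then show ?thesis using card_parking_words_over_top_letters[of N N n b] assms by simp
qed

lemma card_parking_words:
  assumes "n * b \<le> N" "0 < N"
  shows "(\<Sum>xs\<in>words {1..N} n. of_bool (parks N b (mset xs)) :: real) =
         real N ^ n * (real N - real b * real n) / real N"
  unfolding card_parking_words_expanded[OF assms(1)] using assms(2)
  by (cases n) (simp_all add: field_simps)

section \<open>Spoilers of a parking word\<close>

definition spoilers :: "nat \<Rightarrow> nat \<Rightarrow> nat multiset \<Rightarrow> nat set" where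
  "spoilers N b M = {j \<in> {1..N}. \<not> parks N b (add_mset j M)}"

lemma spoilers_subset: "spoilers N b M \<subseteq> {1..N}"
  by (auto simp: spoilers_def)

lemma finite_spoilers [simp]: "finite (spoilers N b M)"
  by (auto simp: spoilers_def)

lemma card_spoilers_le: "card (spoilers N b M) \<le> N"
  using card_mono[OF _ spoilers_subset] by force

lemma parks_add_mset_antimono:
  assumes "parks N b (add_mset k M)" "j \<le> k"
  shows "parks N b (add_mset j M)"
  unfolding parks_def
proof (intro allI impI)
  fix s :: nat assume "1 \<le> s"
  with assms(1) have "top_count N b s (add_mset k M) < s" by (auto simp: parks_def)
  moreover have "top_count N b s (add_mset j M) \<le> top_count N b s (add_mset k M)"
    using assms(2) by (auto simp: of_bool_def)
  ultimately show "top_count N b s (add_mset j M) < s" by linarith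
qed

lemma spoilers_tail: "j \<in> spoilers N b M \<Longrightarrow> {j..N} \<subseteq> spoilers N b M"
  by (auto simp: spoilers_def dest: parks_add_mset_antimono)

lemma spoiler_distance:
  assumes "j \<in> spoilers N b M"
  shows "N - j < card (spoilers N b M)"
proof -
  have "card {j..N} \<le> card (spoilers N b M)"
    using spoilers_tail[OF assms] by (intro card_mono) auto
  moreover have "j \<le> N" using assms by (simp add: spoilers_def)
  ultimately show ?thesis by simp
qed

text \<open>If the smallest spoiler violates the condition at \<open>s\<close>, the word itself is tight at \<open>s\<close>, and all
  spoilers lie in the top \<open>s * b\<close> values. Thus many spoilers force many letters near the top.\<close>

lemma card_spoilers_le_tight:
  assumes "parks N b M" "spoilers N b M \<noteq> {}"
  obtains s where "1 \<le> s" "s \<le> top_count N b s M + 1" "card (spoilers N b M) \<le> b * s"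
proof -
  define j where "j = Min (spoilers N b M)"
  have j: "j \<in> spoilers N b M" unfolding j_def by (rule Min_in) (use assms(2) in auto)
  then obtain s where s: "1 \<le> s" "\<not> top_count N b s (add_mset j M) < s"
    by (auto simp: spoilers_def parks_def)
  have "top_count N b s M < s" using assms(1) s(1) by (simp add: parks_def)
  with s(2) have *: "N < j + s * b" "s \<le> top_count N b s M + 1"
    by (auto simp: of_bool_def split: if_splits)
  have "spoilers N b M \<subseteq> {j..N}"
    using spoilers_subset[of N b M] by (auto simp: j_def)
  then have "card (spoilers N b M) \<le> card {j..N}" by (intro card_mono) auto
  also have "\<dots> \<le> b * s" using *(1) j by (simp add: spoilers_def mult.commute)
  finally show ?thesis using that s(1) *(2) by blast
qed

lemma summable_square_geometric:
  fixes r :: real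
  assumes "0 \<le> r" "r < 1"
  shows "summable (\<lambda>t. real t ^ 2 * r ^ t)"
proof -
  have 1: "summable (\<lambda>n. diffs (\<lambda>_. 1) n * x ^ n)" if "norm x < 1" for x :: real
    using that by (intro termdiff_converges[where K = 1]) (auto simp: summable_geometric)
  have 2: "summable (\<lambda>n. diffs (diffs (\<lambda>_. 1)) n * r ^ n)"
    using assms 1 by (intro termdiff_converges[where K = 1]) auto
  show ?thesis
  proof (rule summable_comparison_test'[OF 2])
    fix n :: nat
    have "real n ^ 2 \<le> diffs (diffs (\<lambda>_. 1)) n"
      by (simp add: diffs_def power2_eq_square algebra_simps)
    then show "norm (real n ^ 2 * r ^ n) \<le> diffs (diffs (\<lambda>_. 1)) n * r ^ n"
      using assms by (simp add: mult_right_mono)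
  qed
qed

text \<open>The exponential moment for the Chernoff bound: under the uniform distribution the letters are
  independent, and each lies in the top \<open>t * b\<close> values with probability at most \<open>t * b / N\<close>.\<close>

lemma sum_words_power_top_count_le:
  fixes z :: real
  assumes "1 \<le> z" "0 < N"
  shows "(\<Sum>xs\<in>words {1..N} n. z ^ top_count N b t (mset xs)) \<le>
         real N ^ n * exp ((z - 1) * (real t * real b) * real n / real N)"
proof -
  have "(\<Sum>x\<in>{1..N}. if N < x + t * b then z else 1) =
        (\<Sum>x\<in>{1..N}. 1 + (z - 1) * of_bool (N < x + t * b))"
    by (intro sum.cong) auto
  also have "\<dots> = real N + (z - 1) * real (card ({1..N} \<inter> {x. N < x + t * b}))"
    by (simp add: sum.distrib flip: sum_distrib_left)
  also have "card ({1..N} \<inter> {x. N < x + t * b}) \<le> card {N - t * b<..N}"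
    by (intro card_mono) auto
  then have "real (card ({1..N} \<inter> {x. N < x + t * b})) \<le> real t * real b"
    by (simp flip: of_nat_mult)
  then have "real N + (z - 1) * real (card ({1..N} \<inter> {x. N < x + t * b})) \<le>
        real N + (z - 1) * (real t * real b)"
    using assms(1) by (intro add_left_mono mult_left_mono) auto
  also have "\<dots> = real N * (1 + (z - 1) * (real t * real b) / real N)"
    using assms(2) by (simp add: field_simps)
  also have "\<dots> \<le> real N * exp ((z - 1) * (real t * real b) / real N)"
    by (intro mult_left_mono exp_ge_add_one_self) auto
  finally have base: "(\<Sum>x\<in>{1..N}. if N < x + t * b then z else 1) \<le>
      real N * exp ((z - 1) * (real t * real b) / real N)" .
  have "(\<Sum>xs\<in>words {1..N} n. z ^ top_count N b t (mset xs)) =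
        (\<Sum>x\<in>{1..N}. if N < x + t * b then z else 1) ^ n"
    unfolding top_count_def by (rule sum_words_power_size_filter) simp
  also have "\<dots> \<le> (real N * exp ((z - 1) * (real t * real b) / real N)) ^ n"
    using base assms(1) by (intro power_mono sum_nonneg) auto
  also have "\<dots> = real N ^ n * exp ((z - 1) * (real t * real b) * real n / real N)"
    by (simp add: power_mult_distrib flip: exp_of_nat2_mult)
  finally show ?thesis .
qed

text \<open>By \<open>card_spoilers_le_tight\<close> the squared number of spoilers is at most the sum of \<open>(b * t) ^ 2\<close> over
  those \<open>t\<close> for which at least \<open>t - 1\<close> letters lie in the top \<open>t * b\<close> values. The expected number of
  such letters is at most \<open>t * b / (b + c)\<close>, so Chernoff's bound makes this event exponentially
  unlikely in \<open>t\<close>, uniformly in \<open>n\<close> and \<open>N\<close>.\<close>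

lemma spoilers_second_moment:
  fixes c :: real
  assumes "1 \<le> b" "0 < c"
  obtains C where "0 \<le> C"
    "\<And>n N. 0 < N \<Longrightarrow> (real b + c) * real n \<le> real N \<Longrightarrow>
       (\<Sum>vs\<in>words {1..N} n. of_bool (parks N b (mset vs)) *
          real (card (spoilers N b (mset vs))) ^ 2) \<le> C * real N ^ n"
proof -
  \<comment> \<open>The base \<open>z\<close>, the inverse of the density \<open>b / (b + c)\<close>, minimises the Chernoff rate \<open>exp ((z - 1) * b / (b + c)) / z\<close>; the minimum is \<open>r < 1\<close>.\<close>
  define z where "z = (real b + c) / real b"
  define r where "r = exp (1 - 1 / z) / z"
  have b: "0 < real b" using assms by simp
  have z: "1 < z" using b assms(2) by (simp add: z_def)
  have "ln (1 / z) < 1 / z - 1"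
    using ln_le_minus_one[of "1 / z"] ln_eq_minus_one[of "1 / z"] z by fastforce
  then have "exp (1 - 1 / z) < exp (ln z)"
    using z by (subst exp_less_cancel_iff) (simp add: ln_div)
  then have r: "0 \<le> r" "r < 1" using z by (auto simp: r_def)
  define S where "S = (\<Sum>t. real t ^ 2 * r ^ t)"
  have S0: "0 \<le> S" unfolding S_def using r
    by (intro suminf_nonneg summable_square_geometric) auto
  show ?thesis
  proof (rule that[of "real b ^ 2 * z * S"])
    show "0 \<le> real b ^ 2 * z * S" using S0 z by simp
    fix n N :: nat
    assume N: "0 < N" and nN: "(real b + c) * real n \<le> real N"
    have density: "real b * real n / real N \<le> 1 / z"
    proof -
      have "real b * ((real b + c) * real n) \<le> real b * real N"
        using nN by (intro mult_left_mono) auto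
      then show ?thesis using N b assms(2) by (simp add: z_def field_simps)
    qed
    have pointwise: "of_bool (parks N b (mset vs)) * real (card (spoilers N b (mset vs))) ^ 2 \<le>
        (\<Sum>t\<in>{1..n + 1}. (real b * real t) ^ 2 * (z ^ top_count N b t (mset vs) * z / z ^ t))"
      (is "?L \<le> sum ?f _") if vs: "vs \<in> words {1..N} n" for vs
    proof -
      have f0: "0 \<le> ?f t" for t using z by simp
      show ?thesis
      proof (cases "parks N b (mset vs) \<and> spoilers N b (mset vs) \<noteq> {}")
        case True
        then obtain s where s: "1 \<le> s" "s \<le> top_count N b s (mset vs) + 1"
          "card (spoilers N b (mset vs)) \<le> b * s"
          using card_spoilers_le_tight by blast
        have "s \<le> n + 1"
          using s(2) top_count_le_size[of N b s "mset vs"] vs by (simp add: words_def)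
        have "z ^ s \<le> z ^ (top_count N b s (mset vs) + 1)"
          using s(2) z by (intro power_increasing) auto
        then have ge1: "1 \<le> z ^ top_count N b s (mset vs) * z / z ^ s"
          using z by (simp add: field_simps)
        have "?L \<le> (real b * real s) ^ 2 * 1"
          using True s(3) by (simp flip: of_nat_mult)
        also have "\<dots> \<le> ?f s" using ge1 by (intro mult_left_mono) auto
        also have "\<dots> \<le> sum ?f {1..n + 1}"
          using s(1) \<open>s \<le> n + 1\<close> f0 by (intro member_le_sum) auto
        finally show ?thesis .
      next
        case False
        then have "?L = 0" by auto
        then show ?thesis using f0 by (simp only: sum_nonneg)
      qed
    qed
    have "(\<Sum>vs\<in>words {1..N} n. of_bool (parks N b (mset vs)) *
             real (card (spoilers N b (mset vs))) ^ 2) \<le>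
          (\<Sum>vs\<in>words {1..N} n. \<Sum>t\<in>{1..n + 1}.
             (real b * real t) ^ 2 * (z ^ top_count N b t (mset vs) * z / z ^ t))"
      by (intro sum_mono pointwise)
    also have "\<dots> = (\<Sum>t\<in>{1..n + 1}. (real b * real t) ^ 2 * z / z ^ t *
             (\<Sum>vs\<in>words {1..N} n. z ^ top_count N b t (mset vs)))"
      by (subst sum.swap) (simp add: sum_distrib_left mult_ac)
    also have "\<dots> \<le> (\<Sum>t\<in>{1..n + 1}. (real b * real t) ^ 2 * z / z ^ t *
             (real N ^ n * exp (1 - 1 / z) ^ t))"
    proof (intro sum_mono mult_left_mono)
      fix t
      have "(z - 1) * (real t * real b) * real n / real N =
            (z - 1) * real t * (real b * real n / real N)" by simp
      also have "\<dots> \<le> (z - 1) * real t * (1 / z)"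
        using z density by (intro mult_left_mono) auto
      also have "\<dots> = real t * (1 - 1 / z)" using z by (simp add: field_simps)
      finally have "exp ((z - 1) * (real t * real b) * real n / real N) \<le> exp (1 - 1 / z) ^ t"
        by (simp flip: exp_of_nat_mult)
      then have "real N ^ n * exp ((z - 1) * (real t * real b) * real n / real N) \<le>
                 real N ^ n * exp (1 - 1 / z) ^ t"
        by (intro mult_left_mono) auto
      then show "(\<Sum>vs\<in>words {1..N} n. z ^ top_count N b t (mset vs)) \<le>
          real N ^ n * exp (1 - 1 / z) ^ t"
        using sum_words_power_top_count_le[of z N b t n] z N by linarith
    qed (use z in auto)
    also have "\<dots> = real b ^ 2 * z * real N ^ n * (\<Sum>t\<in>{1..n + 1}. real t ^ 2 * r ^ t)"
      unfolding sum_distrib_left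
      by (intro sum.cong refl) (simp add: r_def power_mult_distrib power_divide mult_ac)
    also have "\<dots> \<le> real b ^ 2 * z * real N ^ n * S"
      unfolding S_def using r z
      by (intro mult_left_mono sum_le_suminf summable_square_geometric) auto
    finally show "(\<Sum>vs\<in>words {1..N} n. of_bool (parks N b (mset vs)) *
          real (card (spoilers N b (mset vs))) ^ 2) \<le> real b ^ 2 * z * S * real N ^ n"
      by (simp add: mult_ac)
  qed
qed

text \<open>Counting pairs of a parking word and a non-spoiler counts parking words of length \<open>n + 1\<close>. The
  sum is therefore an explicit difference of two parking counts.\<close>

lemma spoilers_first_moment:
  assumes "(n + 1) * b \<le> N" "0 < N"
  shows "(\<Sum>vs\<in>words {1..N} n. of_bool (parks N b (mset vs)) *
           real (card (spoilers N b (mset vs)))) = real b * real N ^ n"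
proof -
  have "(\<Sum>vs\<in>words {1..N} n. of_bool (parks N b (mset vs)) *
           real (card (spoilers N b (mset vs)))) =
        (\<Sum>vs\<in>words {1..N} n. \<Sum>j\<in>{1..N}. of_bool (parks N b (mset vs)) -
           of_bool (parks N b (mset (j # vs))))"
  proof (intro sum.cong refl)
    fix vs :: "nat list"
    let ?M = "mset vs"
    have "real (card (spoilers N b ?M)) = (\<Sum>j\<in>{1..N}. of_bool (\<not> parks N b (add_mset j ?M)))"
      by (simp add: spoilers_def Int_def)
    then have "of_bool (parks N b ?M) * real (card (spoilers N b ?M)) =
       (\<Sum>j\<in>{1..N}. of_bool (parks N b ?M) * of_bool (\<not> parks N b (add_mset j ?M)))"
      by (simp only: sum_distrib_left)
    also have "\<dots> = (\<Sum>j\<in>{1..N}. of_bool (parks N b ?M) - of_bool (parks N b (mset (j # vs))))"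
      by (intro sum.cong refl) (auto dest: parks_add_msetD)
    finally show "of_bool (parks N b ?M) * real (card (spoilers N b ?M)) = \<dots>" .
  qed
  also have "\<dots> = real N * (\<Sum>vs\<in>words {1..N} n. of_bool (parks N b (mset vs))) -
      (\<Sum>vs\<in>words {1..N} (Suc n). of_bool (parks N b (mset vs)))"
    by (subst sum_words_Suc, subst sum.swap)
       (simp add: sum_subtractf sum_distrib_left)
  also have "\<dots> = real b * real N ^ n"
  proof -
    have "n * b \<le> N" "Suc n * b \<le> N" using assms(1) by auto
    with assms(2) show ?thesis
      by (simp only: card_parking_words) (simp add: field_simps)
  qed
  finally show ?thesis .
qed

text \<open>Each factor loses about \<open>x\<close>, so the product loses \<open>x\<close> times its first elementary variation. The
  constant is uniform in the factors because they all lie in the unit interval.\<close>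

lemma prod_diff_first_order:
  fixes \<sigma> \<epsilon> :: "'i \<Rightarrow> real"
  assumes "finite I" "0 \<le> x" "0 \<le> P"
    and "\<And>i. i \<in> I \<Longrightarrow> 0 \<le> \<epsilon> i \<and> \<epsilon> i \<le> \<sigma> i \<and> \<sigma> i \<le> 1 \<and> \<epsilon> i \<le> x \<and> x - \<epsilon> i \<le> P * x ^ 2"
  shows "\<bar>(\<Prod>i\<in>I. \<sigma> i - \<epsilon> i) - ((\<Prod>i\<in>I. \<sigma> i) - x * (\<Sum>i\<in>I. \<Prod>k\<in>I - {i}. \<sigma> k))\<bar>
         \<le> real (card I) * (P + real (card I)) * x ^ 2"
  using assms(1,4)
proof (induction I rule: finite_induct)
  case (insert j F)
  define full where "full = (\<Prod>i\<in>F. \<sigma> i)"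
  define e where "e = (\<Sum>i\<in>F. \<Prod>k\<in>F - {i}. \<sigma> k)"
  define \<Delta> where "\<Delta> = (\<Prod>i\<in>F. \<sigma> i - \<epsilon> i) - (full - x * e)"
  have IH: "\<bar>\<Delta>\<bar> \<le> real (card F) * (P + real (card F)) * x ^ 2"
    unfolding \<Delta>_def full_def e_def using insert by simp
  have j: "0 \<le> \<epsilon> j" "\<epsilon> j \<le> \<sigma> j" "\<sigma> j \<le> 1" "\<epsilon> j \<le> x" "x - \<epsilon> j \<le> P * x ^ 2"
    using insert.prems[of j] by auto
  have \<sigma>: "0 \<le> \<sigma> i" "\<sigma> i \<le> 1" if "i \<in> F" for i
    using insert.prems[of i] that by auto
  have full: "0 \<le> full" "full \<le> 1"
    unfolding full_def using \<sigma> by (auto intro: prod_nonneg prod_le_1)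
  have e: "0 \<le> e" "e \<le> real (card F)"
  proof -
    show "0 \<le> e" unfolding e_def using \<sigma> by (auto intro!: sum_nonneg prod_nonneg)
    have "e \<le> (\<Sum>i\<in>F. 1)" unfolding e_def by (intro sum_mono prod_le_1) (use \<sigma> in auto)
    then show "e \<le> real (card F)" by simp
  qed
  have "(\<Sum>i\<in>F. \<Prod>k\<in>insert j F - {i}. \<sigma> k) = (\<Sum>i\<in>F. \<sigma> j * (\<Prod>k\<in>F - {i}. \<sigma> k))"
  proof (intro sum.cong refl)
    fix i assume "i \<in> F"
    then have "insert j F - {i} = insert j (F - {i})" using insert.hyps by auto
    then show "(\<Prod>k\<in>insert j F - {i}. \<sigma> k) = \<sigma> j * (\<Prod>k\<in>F - {i}. \<sigma> k)"
      using insert.hyps by simp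
  qed
  then have sums: "(\<Sum>i\<in>insert j F. \<Prod>k\<in>insert j F - {i}. \<sigma> k) = full + \<sigma> j * e"
    using insert.hyps by (simp add: full_def e_def sum_distrib_left)
  have "(\<Prod>i\<in>insert j F. \<sigma> i - \<epsilon> i) -
          ((\<Prod>i\<in>insert j F. \<sigma> i) - x * (\<Sum>i\<in>insert j F. \<Prod>k\<in>insert j F - {i}. \<sigma> k)) =
        (\<sigma> j - \<epsilon> j) * \<Delta> + (x - \<epsilon> j) * full + \<epsilon> j * x * e"
    unfolding sums using insert.hyps by (simp add: \<Delta>_def full_def algebra_simps)
  also have "\<bar>\<dots>\<bar> \<le> \<bar>(\<sigma> j - \<epsilon> j) * \<Delta>\<bar> + \<bar>(x - \<epsilon> j) * full\<bar> + \<bar>\<epsilon> j * x * e\<bar>"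
    by linarith
  also have "\<bar>(\<sigma> j - \<epsilon> j) * \<Delta>\<bar> \<le> 1 * \<bar>\<Delta>\<bar>"
    unfolding abs_mult using j by (intro mult_right_mono) auto
  also have "\<bar>(x - \<epsilon> j) * full\<bar> \<le> P * x ^ 2 * 1"
    unfolding abs_mult using j full assms(3) by (intro mult_mono) auto
  also have "\<bar>\<epsilon> j * x * e\<bar> \<le> x * x * real (card F)"
    unfolding abs_mult using j e assms(2) by (intro mult_mono) auto
  also have "1 * \<bar>\<Delta>\<bar> \<le> real (card F) * (P + real (card F)) * x ^ 2"
    using IH by simp
  also have "real (card F) * (P + real (card F)) * x ^ 2 + P * x ^ 2 * 1 + x * x * real (card F) =
     (real (card F) * (P + real (card F)) + P + real (card F)) * x ^ 2"
    by (simp add: algebra_simps power2_eq_square)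
  also have "\<dots> \<le> real (card (insert j F)) * (P + real (card (insert j F))) * x ^ 2"
    using insert.hyps by (intro mult_right_mono) (auto simp: algebra_simps)
  finally show ?case by simp
qed simp

section \<open>Expansion of the mixed moments\<close>

definition power_mean :: "nat \<Rightarrow> nat \<Rightarrow> real" where
  "power_mean p N = (\<Sum>j\<in>{1..N}. (real j / real N) ^ p) / real N"

text \<open>The prefix of length \<open>l\<close> of a parking word \<open>us @ vs\<close> avoids the spoilers of \<open>vs\<close>. Replacing the
  admissible prefixes by all spoiler-free ones turns the inner sum into a product; the excess is
  controlled by the number of superfluous prefixes, because the summands lie in the unit interval.
  In the total of these numbers the zeroth and first order terms in the number of spoilers cancel
  against the exact number of parking words of length \<open>m\<close>, so only the second moment remains.\<close>

lemma PF_moment_expansion: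
  fixes c :: real and q :: "nat \<Rightarrow> nat"
  assumes "1 \<le> b" "0 < c" "1 \<le> l"
  obtains C where "0 \<le> C"
    "\<And>a m N. l \<le> m \<Longrightarrow> real a = c * real m + real b \<Longrightarrow> N = a + m * b \<Longrightarrow>
      \<bar>PF_expectation a b m (\<lambda>\<pi>. \<Prod>i<l. (real (\<pi> ! i) / real N) ^ q i) -
        ((1 + real l * real b / real a) * (\<Prod>i<l. power_mean (q i) N) -
         real b / real a * (\<Sum>i<l. \<Prod>k\<in>{..<l} - {i}. power_mean (q k) N))\<bar>
      \<le> C / (real a * real N)"
proof -
  from assms(1,2) obtain C0 where C0: "0 \<le> C0"
    "\<And>n N. 0 < N \<Longrightarrow> (real b + c) * real n \<le> real N \<Longrightarrow>
       (\<Sum>vs\<in>words {1..N} n. of_bool (parks N b (mset vs)) *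
          real (card (spoilers N b (mset vs))) ^ 2) \<le> C0 * real N ^ n"
    using spoilers_second_moment by blast
  define P where "P = (\<Sum>i<l. real (q i))"
  have P: "real (q i) \<le> P" if "i < l" for i
    unfolding P_def using that by (intro member_le_sum) auto
  have P0: "0 \<le> P" unfolding P_def by (intro sum_nonneg) auto
  define D where "D = real l * (P + real l) + real l * real l"
  have D0: "0 \<le> D" unfolding D_def using P0 by simp
  show ?thesis
  proof (rule that[of "D * C0"])
    show "0 \<le> D * C0" using D0 C0(1) by simp
    fix a m N :: nat
    assume lm: "l \<le> m" and a: "real a = c * real m + real b" and N: "N = a + m * b"
    define n where "n = m - l"
    have m: "m = l + n" using lm by (simp add: n_def)
    have a0: "0 < real a" using a assms by (simp add: add_nonneg_pos)
    then have N0: "0 < N" using N by simp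
    have Nreal: "real N = real a + real m * real b" using N by simp
    have cap: "m * b \<le> N" "(n + 1) * b \<le> N" "n * b \<le> N"
    proof -
      show "m * b \<le> N" using N by simp
      moreover have "(n + 1) * b \<le> m * b" "n * b \<le> m * b"
        by (rule mult_le_mono1, use assms(3) m in simp)+
      ultimately show "(n + 1) * b \<le> N" "n * b \<le> N" by linarith+
    qed
    have density: "(real b + c) * real n \<le> real N"
    proof -
      have "(real b + c) * real n \<le> (real b + c) * real m"
        using m assms(2) by (intro mult_left_mono) auto
      then show ?thesis using a Nreal by (simp add: algebra_simps)
    qed
    \<comment> \<open>For a rest word \<open>vs\<close>: \<open>x vs\<close> is the proportion of spoilers, \<open>good vs\<close> the number of admissible prefixes, and \<open>T vs\<close> the sum of \<open>g\<close> over them.\<close>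
    define \<sigma> where "\<sigma> i = power_mean (q i) N" for i
    define e where "e = (\<Sum>i<l. \<Prod>k\<in>{..<l} - {i}. \<sigma> k)"
    define g where "g us = (\<Prod>i<l. (real (us ! i) / real N) ^ q i)" for us :: "nat list"
    define W where "W = words {1..N}"
    define ok where "ok vs = (of_bool (parks N b (mset vs)) :: real)" for vs
    define x where "x vs = real (card (spoilers N b (mset vs))) / real N" for vs
    define good where "good vs = (\<Sum>us\<in>W l. ok (us @ vs))" for vs
    define T where "T vs = (\<Sum>us\<in>W l. ok (us @ vs) * g us)" for vs
    have g01: "0 \<le> g us" "us \<in> W l \<Longrightarrow> g us \<le> 1" for us
    proof -
      show "0 \<le> g us" unfolding g_def by (intro prod_nonneg) auto
      assume us: "us \<in> W l"
      have "us ! i \<le> N" if "i < l" for i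
        using us that nth_mem[of i us] by (auto simp: W_def words_def subset_iff)
      then show "g us \<le> 1" unfolding g_def using N0
        by (intro prod_le_1) (auto intro!: power_le_one)
    qed
    have \<sigma>1: "\<sigma> i \<le> 1" for i
    proof -
      have "(\<Sum>j\<in>{1..N}. (real j / real N) ^ q i) \<le> (\<Sum>j\<in>{1..N}. 1)"
        using N0 by (intro sum_mono power_le_one) auto
      then show ?thesis using N0 by (simp add: \<sigma>_def power_mean_def)
    qed
    \<comment> \<open>The difference \<open>... - good vs\<close> in the bound is left unestimated here: only after summation over \<open>vs\<close> is it known to be small.\<close>
    have per_word: "\<bar>T vs - real N ^ l * ((\<Prod>i<l. \<sigma> i) - x vs * e)\<bar> \<le>
        real N ^ l * (1 - real l * x vs + D * x vs ^ 2) - good vs"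
      if vs: "ok vs = 1" for vs
    proof -
      define B where "B = spoilers N b (mset vs)"
      define Q where "Q = words ({1..N} - B) l"
      define \<epsilon> where "\<epsilon> i = (\<Sum>j\<in>B. (real j / real N) ^ q i) / real N" for i
      have finB: "finite B" "B \<subseteq> {1..N}" "card B \<le> N"
        using spoilers_subset card_spoilers_le by (auto simp: B_def)
      have x: "x vs = real (card B) / real N" "0 \<le> x vs" "x vs \<le> 1"
        using finB N0 by (auto simp: x_def B_def)
      have QW: "finite Q" "Q \<subseteq> W l" "finite (W l)"
      proof -
        show "finite Q" "finite (W l)" by (simp_all add: Q_def W_def)
        show "Q \<subseteq> W l" by (auto simp: Q_def W_def words_def)
      qed
      have ok0: "ok (us @ vs) = 0" if "us \<in> W l - Q" for us
      proof -
        from that obtain j where j: "j \<in> set us" "j \<in> B"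
          by (auto simp: W_def Q_def words_def)
        from j(1) obtain U where U: "mset us = add_mset j U"
          by (metis insert_DiffM set_mset_mset)
        have "\<not> parks N b (add_mset j (mset vs))" using j(2) by (simp add: B_def spoilers_def)
        then have "\<not> parks N b (U + add_mset j (mset vs))" using parks_unionD by blast
        then show ?thesis by (simp add: ok_def U)
      qed
      have ok1: "ok us \<le> 1" for us by (simp add: ok_def)
      have T: "T vs = (\<Sum>us\<in>Q. ok (us @ vs) * g us)"
        unfolding T_def using QW ok0 by (intro sum.mono_neutral_right) auto
      have good: "good vs = (\<Sum>us\<in>Q. ok (us @ vs))"
        unfolding good_def using QW ok0 by (intro sum.mono_neutral_right) auto
      have "\<bar>(\<Sum>us\<in>Q. g us) - T vs\<bar> = \<bar>\<Sum>us\<in>Q. (1 - ok (us @ vs)) * g us\<bar>"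
        unfolding T by (simp add: algebra_simps sum_subtractf)
      also have "\<dots> = (\<Sum>us\<in>Q. (1 - ok (us @ vs)) * g us)"
        using ok1 g01 by (intro abs_of_nonneg sum_nonneg mult_nonneg_nonneg) auto
      also have "\<dots> \<le> (\<Sum>us\<in>Q. (1 - ok (us @ vs)) * 1)"
        using ok1 g01 QW by (intro sum_mono mult_left_mono) auto
      also have "\<dots> = real (card Q) - good vs"
        by (simp add: good sum_subtractf)
      finally have 1: "\<bar>(\<Sum>us\<in>Q. g us) - T vs\<bar> \<le> real (card Q) - good vs" .
      have "real (card Q) = real N ^ l * (\<Prod>i<l. 1 - x vs)"
      proof -
        have "card Q = (N - card B) ^ l"
          using finB by (simp add: Q_def card_words card_Diff_subset)
        moreover have "real (N - card B) = real N * (1 - x vs)"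
          using finB N0 by (simp add: x of_nat_diff field_simps)
        ultimately show ?thesis by (simp add: power_mult_distrib)
      qed
      also have "(\<Prod>i<l. 1 - x vs) \<le> 1 - real l * x vs + real l * real l * x vs ^ 2"
        using prod_diff_first_order[of "{..<l}" "x vs" 0 "\<lambda>_. x vs" "\<lambda>_. 1"] x
        by (simp add: algebra_simps)
      finally have 2: "real (card Q) \<le>
          real N ^ l * (1 - real l * x vs + real l * real l * x vs ^ 2)"
        using N0 by (simp add: mult_left_mono)
      have "(\<Sum>us\<in>Q. g us) = (\<Prod>i<l. \<Sum>j\<in>{1..N} - B. (real j / real N) ^ q i)"
        unfolding g_def Q_def by (rule sum_words_prod)
      also have "\<dots> = (\<Prod>i<l. real N * (\<sigma> i - \<epsilon> i))"
        using finB N0 by (intro prod.cong refl)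
          (simp add: sum_diff \<sigma>_def power_mean_def \<epsilon>_def field_simps)
      also have "\<dots> = real N ^ l * (\<Prod>i<l. \<sigma> i - \<epsilon> i)"
        by (simp add: prod.distrib)
      finally have 3: "(\<Sum>us\<in>Q. g us) = real N ^ l * (\<Prod>i<l. \<sigma> i - \<epsilon> i)" .
      have "\<bar>(\<Prod>i\<in>{..<l}. \<sigma> i - \<epsilon> i) -
             ((\<Prod>i\<in>{..<l}. \<sigma> i) - x vs * (\<Sum>i\<in>{..<l}. \<Prod>k\<in>{..<l} - {i}. \<sigma> k))\<bar>
          \<le> real (card {..<l}) * (P + real (card {..<l})) * x vs ^ 2"
      proof (rule prod_diff_first_order)
        fix i assume i: "i \<in> {..<l}"
        have "0 \<le> \<epsilon> i" unfolding \<epsilon>_def by (intro divide_nonneg_nonneg sum_nonneg) auto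
        moreover have "\<epsilon> i \<le> \<sigma> i" unfolding \<epsilon>_def \<sigma>_def power_mean_def
          using finB by (intro divide_right_mono sum_mono2) auto
        moreover have "\<epsilon> i \<le> x vs"
        proof -
          have "(\<Sum>j\<in>B. (real j / real N) ^ q i) \<le> (\<Sum>j\<in>B. 1)"
            using finB N0 by (intro sum_mono power_le_one) auto
          then show ?thesis by (simp add: \<epsilon>_def x divide_right_mono)
        qed
        moreover have "x vs - \<epsilon> i \<le> P * x vs ^ 2"
        proof -
          \<comment> \<open>A spoiler lies within distance \<open>card B\<close> of the top, so Bernoulli's inequality keeps its contribution close to 1.\<close>
          have "(\<Sum>j\<in>B. 1 - real (q i) * x vs) \<le> (\<Sum>j\<in>B. (real j / real N) ^ q i)"
          proof (intro sum_mono)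
            fix j assume j: "j \<in> B"
            then have "real N - real j \<le> real (card B)"
              using spoiler_distance[of j N b "mset vs"] by (simp add: B_def)
            then have "- x vs \<le> real j / real N - 1" using N0 by (simp add: x field_simps)
            then have "1 - real (q i) * x vs \<le> 1 + real (q i) * (real j / real N - 1)"
              using mult_left_mono[of "- x vs" "real j / real N - 1" "real (q i)"] by simp
            also have "\<dots> \<le> (1 + (real j / real N - 1)) ^ q i"
              using N0 by (intro Bernoulli_inequality) auto
            finally show "1 - real (q i) * x vs \<le> (real j / real N) ^ q i" by simp
          qed
          then have "real (card B) * (1 - real (q i) * x vs) / real N \<le> \<epsilon> i"
            unfolding \<epsilon>_def by (intro divide_right_mono) auto
          then have "x vs * (1 - real (q i) * x vs) \<le> \<epsilon> i" by (simp add: x)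
          moreover have "real (q i) * x vs ^ 2 \<le> P * x vs ^ 2"
            using P i by (intro mult_right_mono) auto
          ultimately show ?thesis by (simp add: algebra_simps power2_eq_square)
        qed
        ultimately show "0 \<le> \<epsilon> i \<and> \<epsilon> i \<le> \<sigma> i \<and> \<sigma> i \<le> 1 \<and> \<epsilon> i \<le> x vs \<and> x vs - \<epsilon> i \<le> P * x vs ^ 2"
          using \<sigma>1 by simp
      qed (use x P0 in auto)
      then have "real N ^ l * \<bar>(\<Prod>i<l. \<sigma> i - \<epsilon> i) - ((\<Prod>i<l. \<sigma> i) - x vs * e)\<bar> \<le>
                 real N ^ l * (real l * (P + real l) * x vs ^ 2)"
        unfolding e_def by (intro mult_left_mono) auto
      then have 4: "\<bar>(\<Sum>us\<in>Q. g us) - real N ^ l * ((\<Prod>i<l. \<sigma> i) - x vs * e)\<bar> \<le>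
                 real N ^ l * (real l * (P + real l) * x vs ^ 2)"
        unfolding 3 right_diff_distrib[symmetric] abs_mult by simp
      have "real N ^ l * (1 - real l * x vs + D * x vs ^ 2) =
            real N ^ l * (1 - real l * x vs + real l * real l * x vs ^ 2) +
            real N ^ l * (real l * (P + real l) * x vs ^ 2)"
        by (simp add: D_def algebra_simps)
      with 1 2 4 show ?thesis by linarith
    qed
    have T0: "T vs = 0" if "ok vs = 0" for vs
    proof -
      have "ok (us @ vs) = 0" for us
        using that parks_unionD[of N b "mset us" "mset vs"] by (auto simp: ok_def)
      then show ?thesis by (simp add: T_def)
    qed
    have good0: "good vs = 0" if "ok vs = 0" for vs
    proof -
      have "ok (us @ vs) = 0" for us
        using that parks_unionD[of N b "mset us" "mset vs"] by (auto simp: ok_def)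
      then show ?thesis by (simp add: good_def)
    qed
    have bound: "\<bar>T vs - ok vs * (real N ^ l * ((\<Prod>i<l. \<sigma> i) - x vs * e))\<bar> \<le>
        ok vs * (real N ^ l * (1 - real l * x vs + D * x vs ^ 2)) - good vs" for vs
      using per_word[of vs] T0[of vs] good0[of vs] by (cases "ok vs = 1") (auto simp: ok_def)
    define F0 where "F0 = (\<Sum>vs\<in>W n. ok vs)"
    define X1 where "X1 = (\<Sum>vs\<in>W n. ok vs * x vs)"
    define X2 where "X2 = (\<Sum>vs\<in>W n. ok vs * x vs ^ 2)"
    have F0: "F0 = real N ^ n * (real N - real b * real n) / real N"
      unfolding F0_def W_def ok_def using cap N0 by (intro card_parking_words) auto
    have H: "(\<Sum>vs\<in>W n. good vs) = real N ^ m * (real N - real b * real m) / real N"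
    proof -
      have "(\<Sum>vs\<in>W n. good vs) = (\<Sum>xs\<in>W m. ok xs)"
        unfolding good_def W_def m sum_words_append by (rule sum.swap)
      then show ?thesis unfolding W_def ok_def using cap N0 card_parking_words by simp
    qed
    have X1: "X1 = real b * real N ^ n / real N"
    proof -
      have "X1 = (\<Sum>vs\<in>W n. ok vs * real (card (spoilers N b (mset vs)))) / real N"
        by (simp add: X1_def x_def sum_divide_distrib)
      then show ?thesis
        unfolding W_def ok_def using spoilers_first_moment[OF cap(2) N0] by simp
    qed
    have X2: "X2 \<le> C0 * real N ^ n / real N ^ 2"
    proof -
      have "X2 = (\<Sum>vs\<in>W n. ok vs * real (card (spoilers N b (mset vs))) ^ 2) / real N ^ 2"
        by (simp add: X2_def x_def sum_divide_distrib power_divide)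
      then show ?thesis
        unfolding W_def ok_def using C0(2)[OF N0 density] by (simp add: divide_right_mono)
    qed
    have "\<bar>(\<Sum>vs\<in>W n. T vs) - real N ^ l * ((\<Prod>i<l. \<sigma> i) * F0 - e * X1)\<bar> =
          \<bar>\<Sum>vs\<in>W n. T vs - ok vs * (real N ^ l * ((\<Prod>i<l. \<sigma> i) - x vs * e))\<bar>"
      unfolding F0_def X1_def sum_distrib_left sum_subtractf[symmetric]
      by (intro arg_cong[where f = abs] sum.cong refl) (simp add: algebra_simps)
    also have "\<dots> \<le> (\<Sum>vs\<in>W n. ok vs * (real N ^ l * (1 - real l * x vs + D * x vs ^ 2)) - good vs)"
      by (intro order.trans[OF sum_abs] sum_mono bound)
    also have "\<dots> = real N ^ l * (F0 - real l * X1 + D * X2) - (\<Sum>vs\<in>W n. good vs)"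
      unfolding F0_def X1_def X2_def sum_distrib_left sum_subtractf[symmetric] sum.distrib[symmetric]
      by (intro sum.cong refl) (simp add: algebra_simps)
    \<comment> \<open>The cancellation of the zeroth and first order terms.\<close>
    also have "\<dots> = real N ^ l * D * X2"
      unfolding F0 H X1 m using N0 by (simp add: field_simps power_add)
    also have "\<dots> \<le> real N ^ l * D * (C0 * real N ^ n / real N ^ 2)"
      using X2 D0 by (intro mult_left_mono) auto
    also have "\<dots> = D * C0 * real N ^ m / real N ^ 2"
      by (simp add: m power_add)
    finally have main: "\<bar>(\<Sum>vs\<in>W n. T vs) - real N ^ l * ((\<Prod>i<l. \<sigma> i) * F0 - e * X1)\<bar> \<le>
        D * C0 * real N ^ m / real N ^ 2" .
    have card_PF: "real (card (PF a b m)) = real N ^ m * real a / real N"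
    proof -
      have "real (card (PF a b m)) = (\<Sum>xs\<in>W m. ok xs)"
        unfolding PF_eq_parking_words N[symmetric] W_def ok_def by (simp add: Int_def)
      also have "\<dots> = real N ^ m * (real N - real b * real m) / real N"
        unfolding W_def ok_def using cap N0 by (intro card_parking_words) auto
      finally show ?thesis by (simp add: Nreal)
    qed
    have sum_PF: "(\<Sum>\<pi>\<in>PF a b m. g \<pi>) = (\<Sum>vs\<in>W n. T vs)"
    proof -
      have "(\<Sum>\<pi>\<in>PF a b m. g \<pi>) = (\<Sum>xs\<in>W m. ok xs * g xs)"
        unfolding PF_eq_parking_words N[symmetric] W_def ok_def
        by (simp add: sum.inter_filter of_bool_def if_distrib[of "\<lambda>u. u * _"] cong: if_cong)
      also have "\<dots> = (\<Sum>us\<in>W l. \<Sum>vs\<in>W n. ok (us @ vs) * g (us @ vs))"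
        unfolding W_def m by (rule sum_words_append)
      also have "\<dots> = (\<Sum>us\<in>W l. \<Sum>vs\<in>W n. ok (us @ vs) * g us)"
        by (intro sum.cong refl arg_cong2[where f = "(*)"])
           (auto simp: g_def nth_append W_def words_def intro!: prod.cong)
      also have "\<dots> = (\<Sum>vs\<in>W n. T vs)"
        unfolding T_def by (rule sum.swap)
      finally show ?thesis .
    qed
    have "1 \<le> a" using a0 by simp
    then have "PF_expectation a b m g = (\<Sum>vs\<in>W n. T vs) / real (card (PF a b m))"
      unfolding PF_expectation_def sum_PF[symmetric]
      by (intro integral_pmf_of_set PF_nonempty finite_PF)
    moreover have "(1 + real l * real b / real a) * (\<Prod>i<l. \<sigma> i) - real b / real a * e =
        real N ^ l * ((\<Prod>i<l. \<sigma> i) * F0 - e * X1) / real (card (PF a b m))"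
    proof -
      have F0': "F0 = real N ^ n * (real a + real l * real b) / real N"
        unfolding F0 Nreal m by (simp add: algebra_simps)
      show ?thesis unfolding F0' X1 card_PF unfolding m using N0 a0
        by (simp add: field_simps power_add)
    qed
    ultimately have "\<bar>PF_expectation a b m g -
        ((1 + real l * real b / real a) * (\<Prod>i<l. \<sigma> i) - real b / real a * e)\<bar> =
        \<bar>(\<Sum>vs\<in>W n. T vs) - real N ^ l * ((\<Prod>i<l. \<sigma> i) * F0 - e * X1)\<bar> / real (card (PF a b m))"
      by (simp flip: diff_divide_distrib)
    also have "\<dots> \<le> (D * C0 * real N ^ m / real N ^ 2) / real (card (PF a b m))"
      using main by (intro divide_right_mono) auto
    also have "\<dots> = D * C0 / (real a * real N)"
      unfolding card_PF using N0 a0 by (simp add: field_simps power2_eq_square)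
    finally show "\<bar>PF_expectation a b m (\<lambda>\<pi>. \<Prod>i<l. (real (\<pi> ! i) / real N) ^ q i) -
        ((1 + real l * real b / real a) * (\<Prod>i<l. power_mean (q i) N) -
         real b / real a * (\<Sum>i<l. \<Prod>k\<in>{..<l} - {i}. power_mean (q k) N))\<bar>
      \<le> D * C0 / (real a * real N)"
      unfolding g_def \<sigma>_def e_def .
  qed
qed

section \<open>Power means by the trapezoidal rule\<close>

text \<open>Factor \<open>y ^ (p + 1) - x ^ (p + 1)\<close> as \<open>(y - x) * (\<Sum>i\<le>p. x ^ (p - i) * y ^ i)\<close> and pair the summands \<open>i\<close> and
  \<open>p - i\<close>. The deviation of such a pair from \<open>x ^ p + y ^ p\<close> is
  \<open>(y ^ i - x ^ i) * (y ^ (p - i) - x ^ (p - i))\<close>, which is of second order in \<open>y - x\<close>.\<close>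

lemma trapezoid_power:
  fixes x y :: real
  assumes "0 \<le> x" "x \<le> y" "y \<le> 1"
  shows "\<bar>(y ^ Suc p - x ^ Suc p) / real (Suc p) - (y - x) * (x ^ p + y ^ p) / 2\<bar>
         \<le> real p ^ 2 / 2 * (y - x) ^ 3"
proof -
  define S where "S = (\<Sum>i\<le>p. x ^ (p - i) * y ^ i)"
  define E where "E = (\<Sum>i\<le>p. (y ^ i - x ^ i) * (y ^ (p - i) - x ^ (p - i)))"
  have S1: "y ^ Suc p - x ^ Suc p = (y - x) * S"
    unfolding S_def power_diff_sumr2 lessThan_Suc_atMost by simp
  have S2: "S = (\<Sum>i\<le>p. x ^ i * y ^ (p - i))"
    unfolding S_def by (rule sum.reindex_bij_witness[of _ "\<lambda>i. p - i" "\<lambda>i. p - i"]) auto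
  have "E = (\<Sum>i\<le>p. y ^ p + x ^ p - (x ^ (p - i) * y ^ i + x ^ i * y ^ (p - i)))"
    unfolding E_def
  proof (intro sum.cong refl)
    fix i assume "i \<in> {..p}"
    then have "y ^ i * y ^ (p - i) = y ^ p" "x ^ i * x ^ (p - i) = x ^ p"
      by (simp_all flip: power_add)
    then show "(y ^ i - x ^ i) * (y ^ (p - i) - x ^ (p - i)) =
          y ^ p + x ^ p - (x ^ (p - i) * y ^ i + x ^ i * y ^ (p - i))"
      by (simp add: algebra_simps)
  qed
  also have "\<dots> = real (Suc p) * (x ^ p + y ^ p) - 2 * S"
    using S_def S2 by (simp add: sum_subtractf sum.distrib algebra_simps)
  finally have E: "S = (real (Suc p) * (x ^ p + y ^ p) - E) / 2" by simp
  have "\<bar>E\<bar> \<le> (\<Sum>i\<le>p. real p ^ 2 * (y - x) ^ 2)"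
    unfolding E_def
  proof (intro order.trans[OF sum_abs] sum_mono)
    fix i assume i: "i \<in> {..p}"
    have d: "\<bar>y ^ j - x ^ j\<bar> \<le> real p * (y - x)" if "j \<le> p" for j
    proof -
      have "norm (y ^ j - x ^ j) \<le> real j * norm (y - x)"
        using assms by (intro norm_power_diff) auto
      also have "\<dots> \<le> real p * (y - x)" using that assms by (simp add: mult_right_mono)
      finally show ?thesis by simp
    qed
    have "\<bar>y ^ i - x ^ i\<bar> * \<bar>y ^ (p - i) - x ^ (p - i)\<bar> \<le> (real p * (y - x)) * (real p * (y - x))"
      using d[of i] d[of "p - i"] i assms by (intro mult_mono) auto
    then show "\<bar>(y ^ i - x ^ i) * (y ^ (p - i) - x ^ (p - i))\<bar> \<le> real p ^ 2 * (y - x) ^ 2"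
      by (simp add: abs_mult power2_eq_square mult_ac)
  qed
  then have Ebound: "\<bar>E\<bar> \<le> real (Suc p) * (real p ^ 2 * (y - x) ^ 2)" by simp
  have "(y ^ Suc p - x ^ Suc p) / real (Suc p) - (y - x) * (x ^ p + y ^ p) / 2 =
        - ((y - x) / (2 * real (Suc p)) * E)"
    unfolding S1 E by (simp add: field_simps)
  then have "\<bar>(y ^ Suc p - x ^ Suc p) / real (Suc p) - (y - x) * (x ^ p + y ^ p) / 2\<bar> =
        (y - x) / (2 * real (Suc p)) * \<bar>E\<bar>"
    using assms by (simp add: abs_mult)
  also have "\<dots> \<le> (y - x) / (2 * real (Suc p)) * (real (Suc p) * (real p ^ 2 * (y - x) ^ 2))"
    using Ebound assms by (intro mult_left_mono) auto
  also have "\<dots> = real p ^ 2 / 2 * (y - x) ^ 3"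
    by (simp add: field_simps power2_eq_square power3_eq_cube del: of_nat_Suc)
  finally show ?thesis .
qed

text \<open>Summing the trapezoidal rule over the grid of mesh \<open>1 / N\<close> telescopes to \<open>1 / (p + 1)\<close>. The term
  \<open>1 / (2 * N)\<close> arises because the right-endpoint sum counts the value 1 at the right end fully
  instead of half, while the value at 0 vanishes for \<open>p \<ge> 1\<close>.\<close>

lemma power_mean_estimate:
  assumes "1 \<le> p" "0 < N"
  shows "\<bar>power_mean p N - (1 / (real p + 1) + 1 / (2 * real N))\<bar> \<le> real p ^ 2 / 2 / real N ^ 2"
proof -
  define \<phi> where "\<phi> j = real j / real N" for j
  have step: "\<phi> (Suc j) - \<phi> j = 1 / real N" for j
    by (simp add: \<phi>_def add_divide_distrib)
  have tele: "(\<Sum>j<N. \<phi> (Suc j) ^ k - \<phi> j ^ k) = 1" if "1 \<le> k" for k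
    using that assms(2) by (subst sum_lessThan_telescope) (auto simp: \<phi>_def)
  define Q where "Q = (\<Sum>j<N. \<phi> (Suc j) ^ p)"
  have Q: "power_mean p N = Q / real N"
    unfolding power_mean_def Q_def \<phi>_def by (simp only: One_nat_def sum.atLeast1_atMost_eq)
  have "(\<Sum>j<N. \<phi> j ^ p) = Q - 1"
    using tele[OF assms(1)] by (simp add: Q_def sum_subtractf)
  then have "1 / real (Suc p) - (Q + (Q - 1)) / (2 * real N) =
    (\<Sum>j<N. (\<phi> (Suc j) ^ Suc p - \<phi> j ^ Suc p)) / real (Suc p) -
    (\<Sum>j<N. \<phi> j ^ p + \<phi> (Suc j) ^ p) / (2 * real N)"
    using tele[of "Suc p"] by (simp add: Q_def sum.distrib add.commute)
  also have "\<dots> = (\<Sum>j<N. (\<phi> (Suc j) ^ Suc p - \<phi> j ^ Suc p) / real (Suc p) -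
      (\<phi> (Suc j) - \<phi> j) * (\<phi> j ^ p + \<phi> (Suc j) ^ p) / 2)"
    unfolding sum_divide_distrib sum_subtractf[symmetric]
    by (intro sum.cong refl) (simp add: step)
  also have "\<bar>\<dots>\<bar> \<le> (\<Sum>j<N. real p ^ 2 / 2 * (\<phi> (Suc j) - \<phi> j) ^ 3)"
    by (intro order.trans[OF sum_abs] sum_mono trapezoid_power) (auto simp: \<phi>_def divide_right_mono)
  also have "\<dots> = real p ^ 2 / 2 / real N ^ 2"
    using assms(2) unfolding step
    by (simp add: power_divide field_simps power2_eq_square power3_eq_cube)
  finally have "\<bar>1 / real (Suc p) - (Q + (Q - 1)) / (2 * real N)\<bar> \<le> real p ^ 2 / 2 / real N ^ 2" .
  moreover have "power_mean p N - (1 / (real p + 1) + 1 / (2 * real N)) =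
      - (1 / real (Suc p) - (Q + (Q - 1)) / (2 * real N))"
  proof -
    have "(Q + (Q - 1)) / (2 * real N) = Q / real N - 1 / (2 * real N)"
      using assms(2) by (simp add: field_simps)
    then show ?thesis unfolding Q by (simp add: add.commute)
  qed
  ultimately show ?thesis by (simp only: abs_minus)
qed

section \<open>First-order expansions in the inverse length\<close>

definition first_order :: "nat filter \<Rightarrow> (nat \<Rightarrow> real) \<Rightarrow> real \<Rightarrow> real \<Rightarrow> bool" where
  "first_order F f u v \<longleftrightarrow> (\<lambda>m. f m - (u + v / real m)) \<in> O[F](\<lambda>m. 1 / real m ^ 2)"

lemma first_order_exact: "first_order F (\<lambda>m. u + v / real m) u v"
  by (simp add: first_order_def)

lemma first_order_const: "first_order F (\<lambda>_. u) u 0"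
  by (simp add: first_order_def)

lemma first_order_cong:
  assumes "\<forall>\<^sub>F m in F. f m = g m" "first_order F g u v"
  shows "first_order F f u v"
proof -
  have "\<forall>\<^sub>F m in F. f m - (u + v / real m) = g m - (u + v / real m)"
    using assms(1) by eventually_elim simp
  from landau_o.big.in_cong[OF this] show ?thesis using assms(2) by (simp add: first_order_def)
qed

lemma first_order_approx:
  assumes "first_order F g u v" "\<forall>\<^sub>F m in F. \<bar>f m - g m\<bar> \<le> C / real m ^ 2"
  shows "first_order F f u v"
proof -
  have "(\<lambda>m. f m - g m) \<in> O[F](\<lambda>m. 1 / real m ^ 2)"
    using assms(2) by (intro bigoI[where c = C]) (auto elim!: eventually_mono)
  from sum_in_bigo(1)[OF this assms(1)[unfolded first_order_def]]
  have "(\<lambda>m. (f m - g m) + (g m - (u + v / real m))) \<in> O[F](\<lambda>m. 1 / real m ^ 2)" .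
  moreover have "(\<lambda>m. (f m - g m) + (g m - (u + v / real m))) = (\<lambda>m. f m - (u + v / real m))"
    by (simp add: fun_eq_iff)
  ultimately show ?thesis by (simp only: first_order_def)
qed

lemma first_order_add:
  assumes "first_order F f u v" "first_order F g u' v'"
  shows "first_order F (\<lambda>m. f m + g m) (u + u') (v + v')"
proof -
  have "(\<lambda>m. (f m - (u + v / real m)) + (g m - (u' + v' / real m))) \<in> O[F](\<lambda>m. 1 / real m ^ 2)"
    using assms unfolding first_order_def by (rule sum_in_bigo)
  then show ?thesis by (simp add: first_order_def add_divide_distrib algebra_simps)
qed

lemma first_order_mult:
  assumes F: "F \<le> at_top"
    and f: "first_order F f u v" and g: "first_order F g u' v'"
  shows "first_order F (\<lambda>m. f m * g m) (u * u') (u * v' + v * u')"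
proof -
  have lin: "(\<lambda>m. s + t / real m) \<in> O[F](\<lambda>_. 1)" for s t :: real
    by (rule landau_o.big.filter_mono[OF F]) real_asymp
  have "(\<lambda>m. 1 / real m ^ 2) \<in> O[F](\<lambda>_. 1)"
    by (rule landau_o.big.filter_mono[OF F]) real_asymp
  with g have "(\<lambda>m. g m - (u' + v' / real m)) \<in> O[F](\<lambda>_. 1)"
    unfolding first_order_def by (rule landau_o.big_trans)
  from sum_in_bigo(1)[OF this lin[of u' v']] have g1: "g \<in> O[F](\<lambda>_. 1)" by simp
  have 1: "(\<lambda>m. (f m - (u + v / real m)) * g m) \<in> O[F](\<lambda>m. 1 / real m ^ 2)"
    using landau_o.big.mult[OF f[unfolded first_order_def] g1] by simp
  have 2: "(\<lambda>m. (u + v / real m) * (g m - (u' + v' / real m))) \<in> O[F](\<lambda>m. 1 / real m ^ 2)"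
    using landau_o.big.mult[OF lin g[unfolded first_order_def]] by simp
  have 3: "(\<lambda>m. v * v' * (1 / real m ^ 2)) \<in> O[F](\<lambda>m. 1 / real m ^ 2)"
    by (intro bigoI[where c = "\<bar>v * v'\<bar>"]) (simp add: abs_mult)
  have "(\<lambda>m. f m * g m - (u * u' + (u * v' + v * u') / real m)) =
        (\<lambda>m. (f m - (u + v / real m)) * g m + (u + v / real m) * (g m - (u' + v' / real m)) +
             v * v' * (1 / real m ^ 2))"
  proof
    fix m
    define h where "h = 1 / real m"
    have "1 / real m ^ 2 = h ^ 2" "\<And>t. t / real m = t * h" by (simp_all add: h_def power_divide)
    then show "f m * g m - (u * u' + (u * v' + v * u') / real m) =
        (f m - (u + v / real m)) * g m + (u + v / real m) * (g m - (u' + v' / real m)) +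
             v * v' * (1 / real m ^ 2)"
      by (simp add: algebra_simps power2_eq_square)
  qed
  then show ?thesis
    unfolding first_order_def using sum_in_bigo(1)[OF sum_in_bigo(1)[OF 1 2] 3] by simp
qed

lemma first_order_sum:
  assumes "finite I" "\<And>i. i \<in> I \<Longrightarrow> first_order F (f i) (u i) (v i)"
  shows "first_order F (\<lambda>m. \<Sum>i\<in>I. f i m) (\<Sum>i\<in>I. u i) (\<Sum>i\<in>I. v i)"
  using assms
  by (induction I rule: finite_induct) (auto intro: first_order_add simp: first_order_const)

text \<open>Logarithmic form of the product rule, whence the leading coefficients must not vanish.\<close>

lemma first_order_prod:
  assumes F: "F \<le> at_top" and "finite I"
    and "\<And>i. i \<in> I \<Longrightarrow> first_order F (f i) (u i) (v i)" "\<And>i. i \<in> I \<Longrightarrow> u i \<noteq> 0"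
  shows "first_order F (\<lambda>m. \<Prod>i\<in>I. f i m) (\<Prod>i\<in>I. u i) ((\<Prod>i\<in>I. u i) * (\<Sum>i\<in>I. v i / u i))"
  using assms(2-)
proof (induction I rule: finite_induct)
  case (insert j I)
  have "first_order F (\<lambda>m. f j m * (\<Prod>i\<in>I. f i m)) (u j * (\<Prod>i\<in>I. u i))
          (u j * ((\<Prod>i\<in>I. u i) * (\<Sum>i\<in>I. v i / u i)) + v j * (\<Prod>i\<in>I. u i))"
    using insert by (intro first_order_mult[OF F]) auto
  moreover have "u j * ((\<Prod>i\<in>I. u i) * (\<Sum>i\<in>I. v i / u i)) + v j * (\<Prod>i\<in>I. u i) =
      (\<Prod>i\<in>insert j I. u i) * (\<Sum>i\<in>insert j I. v i / u i)"
    using insert.hyps insert.prems(2)[of j] by (simp add: field_simps)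
  ultimately show ?case using insert.hyps by simp
qed (simp add: first_order_const)

lemma first_order_inverse_linear:
  fixes s t :: real
  assumes "F \<le> at_top" "0 < s" "0 < t"
  shows "first_order F (\<lambda>m. 1 / (s * real m + t)) 0 (1 / s)"
proof (rule first_order_approx)
  show "first_order F (\<lambda>m. 0 + 1 / s / real m) 0 (1 / s)" by (rule first_order_exact)
  have "\<forall>\<^sub>F m in F. 1 \<le> m" using filter_leD[OF assms(1) eventually_ge_at_top] .
  then show "\<forall>\<^sub>F m in F. \<bar>1 / (s * real m + t) - (0 + 1 / s / real m)\<bar> \<le> (t / s ^ 2) / real m ^ 2"
  proof eventually_elim
    case (elim m)
    then have m: "0 < s * real m" using assms(2) by simp
    have "1 / (s * real m + t) - (0 + 1 / s / real m) = - (t / (s * real m * (s * real m + t)))"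
    proof -
      have "s * real m + t \<noteq> 0" using m assms(3) by linarith
      then show ?thesis using m assms(2) elim by (simp add: divide_simps)
    qed
    moreover have "t / (s * real m * (s * real m + t)) \<le> t / (s * real m * (s * real m))"
      using m assms(3) by (intro frac_le mult_left_mono mult_pos_pos[OF m m]) auto
    moreover have "t / (s * real m * (s * real m)) = (t / s ^ 2) / real m ^ 2"
      by (simp add: power2_eq_square mult_ac)
    moreover have "0 \<le> t / (s * real m * (s * real m + t))" using m assms(3) by simp
    ultimately show ?case by linarith
  qed
qed

section \<open>Asymptotics of the mixed moments\<close>

theorem theorem3p5:
  fixes l b :: nat and p :: "nat \<Rightarrow> nat" and c :: real and a :: "nat \<Rightarrow> nat"
  assumes "1 \<le> l" and "1 \<le> b" and "\<forall>i\<in>{1..l}. 1 \<le> p i" and "0 < c"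
    and "\<forall>m. c * real m \<in> \<int> \<longrightarrow> real (a m) = c * real m + real b"
  shows "\<exists>R. R \<in> O[at_top_int_mult c](\<lambda>m. 1 / real m ^ 2) \<and>
    (\<forall>\<^sub>F m in at_top_int_mult c.
      PF_expectation (a m) b m (\<lambda>\<pi>. \<Prod>i=1..l. real (\<pi> ! (i - 1)) ^ p i) =
        ((real b + c) * real m) ^ (\<Sum>i=1..l. p i) / (\<Prod>i=1..l. (real (p i) + 1)) *
        (1 + 1 / (c * (real b + c) * real m) *
               (c * ((\<Sum>i=1..l. real (p i)) + real l) / 2
                 - real b ^ 2 * (\<Sum>i=1..l. real (p i)))
           + R m))"
proof -
  define F where "F = at_top_int_mult c"
  have F: "F \<le> at_top" by (simp add: F_def at_top_int_mult_def)
  define q where "q i = p (Suc i)" for i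
  have q: "1 \<le> q i" if "i < l" for i using assms(3) that by (auto simp: q_def)
  define P where "P = (\<Sum>i<l. q i)"
  define K where "K = (\<Prod>i<l. real (q i) + 1)"
  have K: "0 < K" unfolding K_def by (intro prod_pos) auto
  define N where "N m = a m + m * b" for m
  define h where "h = real b + c"
  have b: "0 < real b" using assms(2) by simp
  have h: "0 < h" using assms(4) by (simp add: h_def)
  define E where "E m = PF_expectation (a m) b m (\<lambda>\<pi>. \<Prod>i<l. real (\<pi> ! i) ^ q i)" for m
  define G where "G m = PF_expectation (a m) b m (\<lambda>\<pi>. \<Prod>i<l. (real (\<pi> ! i) / real (N m)) ^ q i)" for m
  have ev: "\<forall>\<^sub>F m in F. 0 < m \<and> l \<le> m \<and> real (a m) = c * real m + real b \<and>
              real (N m) = h * real m + real b"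
  proof -
    have "\<forall>\<^sub>F m in F. c * real m \<in> \<int>"
      unfolding F_def at_top_int_mult_def eventually_inf_principal by simp
    moreover have "\<forall>\<^sub>F m in F. Suc l \<le> m"
      using filter_leD[OF F eventually_ge_at_top] .
    ultimately show ?thesis
    proof eventually_elim
      case (elim m)
      then show ?case using assms(5) by (auto simp: N_def h_def algebra_simps)
    qed
  qed
  have mean: "first_order F (\<lambda>m. power_mean (q i) (N m)) (1 / (real (q i) + 1)) (1 / (2 * h))"
    if "i < l" for i
  proof (rule first_order_approx)
    show "first_order F (\<lambda>m. 1 / (real (q i) + 1) + 1 / (2 * h * real m + 2 * real b))
            (1 / (real (q i) + 1)) (1 / (2 * h))"
      using first_order_add[OF first_order_const first_order_inverse_linear[OF F, of "2 * h" "2 * real b"]] h b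
      by simp
    show "\<forall>\<^sub>F m in F. \<bar>power_mean (q i) (N m) -
            (1 / (real (q i) + 1) + 1 / (2 * h * real m + 2 * real b))\<bar> \<le>
          (real (q i) ^ 2 / 2 / h ^ 2) / real m ^ 2"
      using ev
    proof eventually_elim
      case (elim m)
      then have N: "0 < N m" using h by (metis add_pos_nonneg mult_pos_pos of_nat_0_le_iff of_nat_0_less_iff)
      have "(h * real m) ^ 2 \<le> real (N m) ^ 2"
        using elim h by (intro power_mono) auto
      then have "real (q i) ^ 2 / 2 / real (N m) ^ 2 \<le> real (q i) ^ 2 / 2 / (h * real m) ^ 2"
        using elim h N by (intro divide_left_mono) auto
      with power_mean_estimate[OF q[OF that] N] elim show ?case
        by (simp add: power_mult_distrib algebra_simps)
    qed
  qed
  define u where "u = (\<Prod>i<l. 1 / (real (q i) + 1))"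
  have uK: "u * K = 1" unfolding u_def K_def prod.distrib[symmetric] by (simp add: prod.neutral)
  define e where "e m = (\<Sum>i<l. \<Prod>k\<in>{..<l} - {i}. power_mean (q k) (N m))" for m
  have sum_q: "(\<Sum>i<l. real (q i) + 1) = real P + real l"
    by (simp add: P_def sum.distrib)
  have prod_mean: "first_order F (\<lambda>m. \<Prod>i<l. power_mean (q i) (N m)) u (u * (real P + real l) / (2 * h))"
  proof -
    have "(\<Sum>i<l. 1 / (2 * h) / (1 / (real (q i) + 1))) = (\<Sum>i<l. real (q i) + 1) / (2 * h)"
      by (simp add: sum_divide_distrib)
    then show ?thesis
      using first_order_prod[OF F, of "{..<l}" "\<lambda>i m. power_mean (q i) (N m)"
        "\<lambda>i. 1 / (real (q i) + 1)" "\<lambda>_. 1 / (2 * h)"] mean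
      unfolding sum_q u_def[symmetric] by (simp add: add_nonneg_eq_0_iff add.commute)
  qed
  obtain w where e: "first_order F e (u * (real P + real l)) w"
  proof -
    have "first_order F e (\<Sum>i<l. \<Prod>k\<in>{..<l} - {i}. 1 / (real (q k) + 1))
      (\<Sum>i<l. (\<Prod>k\<in>{..<l} - {i}. 1 / (real (q k) + 1)) *
         (\<Sum>k\<in>{..<l} - {i}. 1 / (2 * h) / (1 / (real (q k) + 1))))"
      unfolding e_def by (intro first_order_sum first_order_prod[OF F] mean) auto
    moreover have "(\<Sum>i<l. \<Prod>k\<in>{..<l} - {i}. 1 / (real (q k) + 1)) = u * (real P + real l)"
    proof -
      have "(\<Prod>k\<in>{..<l} - {i}. 1 / (real (q k) + 1)) = u * (real (q i) + 1)" if "i < l" for i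
        unfolding u_def using that by (subst (2) prod.remove[of _ i]) auto
      then show ?thesis unfolding sum_q[symmetric] by (simp add: sum_distrib_left)
    qed
    ultimately show ?thesis using that by simp
  qed
  have inv_a: "first_order F (\<lambda>m. t / real (a m)) 0 (t / c)" for t
  proof (rule first_order_cong)
    show "\<forall>\<^sub>F m in F. t / real (a m) = t * (1 / (c * real m + real b))"
      using ev by eventually_elim simp
    show "first_order F (\<lambda>m. t * (1 / (c * real m + real b))) 0 (t / c)"
      using first_order_mult[OF F first_order_const first_order_inverse_linear[OF F assms(4) b]]
      by simp
  qed
  \<comment> \<open>The first-order coefficient of the expression in \<open>PF_moment_expansion\<close>. As \<open>b / a\<close> is itself of order \<open>1 / m\<close>, \<open>e\<close> contributes through its limit alone.\<close>
  define V where "V = u * (real P + real l) / (2 * h) + real l * real b / c * u -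
      real b / c * (u * (real P + real l))"
  have G: "first_order F G u V"
  proof -
    obtain C where C: "0 \<le> C"
      "\<And>a m N. l \<le> m \<Longrightarrow> real a = c * real m + real b \<Longrightarrow> N = a + m * b \<Longrightarrow>
        \<bar>PF_expectation a b m (\<lambda>\<pi>. \<Prod>i<l. (real (\<pi> ! i) / real N) ^ q i) -
          ((1 + real l * real b / real a) * (\<Prod>i<l. power_mean (q i) N) -
           real b / real a * (\<Sum>i<l. \<Prod>k\<in>{..<l} - {i}. power_mean (q k) N))\<bar>
        \<le> C / (real a * real N)"
      using PF_moment_expansion[OF assms(2,4,1)] by blast
    show ?thesis
    proof (rule first_order_approx)
      have "first_order F (\<lambda>m. (1 + real l * real b / real (a m)) * (\<Prod>i<l. power_mean (q i) (N m)) +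
              (- real b) / real (a m) * e m)
          ((1 + 0) * u + 0 * (u * (real P + real l)))
          ((1 + 0) * (u * (real P + real l) / (2 * h)) + (0 + real l * real b / c) * u +
            (0 * w + (- real b) / c * (u * (real P + real l))))"
        by (intro first_order_add first_order_mult[OF F] first_order_const inv_a prod_mean e)
      then show "first_order F (\<lambda>m. (1 + real l * real b / real (a m)) *
            (\<Prod>i<l. power_mean (q i) (N m)) - real b / real (a m) * e m) u V"
        by (simp add: V_def)
      show "\<forall>\<^sub>F m in F. \<bar>G m - ((1 + real l * real b / real (a m)) *
            (\<Prod>i<l. power_mean (q i) (N m)) - real b / real (a m) * e m)\<bar> \<le> (C / (c * h)) / real m ^ 2"
        using ev
      proof eventually_elim
        case (elim m)
        then have m: "0 < real m" by simp
        have "\<bar>G m - ((1 + real l * real b / real (a m)) *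
            (\<Prod>i<l. power_mean (q i) (N m)) - real b / real (a m) * e m)\<bar> \<le>
            C / (real (a m) * real (N m))"
          unfolding G_def e_def using elim by (intro C(2)) (auto simp: N_def)
        also have "\<dots> \<le> C / ((c * real m) * (h * real m))"
        proof (intro divide_left_mono mult_mono C(1))
          show "c * real m \<le> real (a m)" "h * real m \<le> real (N m)" using elim by auto
          then have "0 < real (a m)" "0 < real (N m)"
            using m h assms(4) by (auto intro: less_le_trans[OF mult_pos_pos] simp del: of_nat_0_less_iff)
          then show "0 < real (a m) * real (N m) * (c * real m * (h * real m))"
            using m h assms(4) by simp
        qed (use m h assms(4) in auto)
        also have "\<dots> = (C / (c * h)) / real m ^ 2" by (simp add: power2_eq_square mult_ac)
        finally show ?case .
      qed
    qed
  qed
  have scale: "first_order F (\<lambda>m. (real (N m) / (h * real m)) ^ P) 1 (real P * real b / h)"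
  proof (rule first_order_cong)
    show "\<forall>\<^sub>F m in F. (real (N m) / (h * real m)) ^ P = (\<Prod>i<P. 1 + real b / h / real m)"
      using ev by eventually_elim (use h in \<open>simp add: field_simps\<close>)
    show "first_order F (\<lambda>m. \<Prod>i<P. 1 + real b / h / real m) 1 (real P * real b / h)"
      using first_order_prod[OF F, of "{..<P}" "\<lambda>i m. 1 + real b / h / real m" "\<lambda>_. 1" "\<lambda>_. real b / h"]
        first_order_exact[of F 1 "real b / h"] by simp
  qed
  have E: "E m = real (N m) ^ P * G m" if "0 < N m" for m
  proof -
    have "(\<Prod>i<l. real (\<pi> ! i) ^ q i) = real (N m) ^ P * (\<Prod>i<l. (real (\<pi> ! i) / real (N m)) ^ q i)"
      for \<pi> :: "nat list"
      unfolding P_def power_sum prod.distrib[symmetric] using that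
      by (intro prod.cong refl) (simp add: power_divide)
    then show ?thesis unfolding E_def G_def PF_expectation_def by simp
  qed
  define A where "A = 1 / (c * (real b + c)) *
       (c * (real P + real l) / 2 - real b ^ 2 * real P)"
  define R where "R m = E m / ((h * real m) ^ P / K) - (1 + A / real m)" for m
  have "first_order F (\<lambda>m. E m / ((h * real m) ^ P / K)) 1 A"
  proof (rule first_order_cong)
    show "\<forall>\<^sub>F m in F. E m / ((h * real m) ^ P / K) = K * ((real (N m) / (h * real m)) ^ P * G m)"
      using ev
    proof eventually_elim
      case (elim m)
      then have "0 < N m" using h by (metis add_pos_nonneg mult_pos_pos of_nat_0_le_iff of_nat_0_less_iff)
      then show ?case by (simp add: E power_divide)
    qed
    have "first_order F (\<lambda>m. K * ((real (N m) / (h * real m)) ^ P * G m)) (K * (1 * u))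
            (K * (1 * V + real P * real b / h * u) + 0 * (1 * u))"
      by (intro first_order_mult[OF F] first_order_const scale G)
    moreover have "K * (1 * V + real P * real b / h * u) = A"
    proof -
      have "K * (1 * V + real P * real b / h * u) =
        (u * K) * ((real P + real l) / (2 * h) + real l * real b / c -
           real b / c * (real P + real l) + real P * real b / h)"
        by (simp add: V_def algebra_simps)
      also have "\<dots> = A"
        unfolding uK A_def h_def[symmetric] using h assms(4)
        by (simp add: field_simps power2_eq_square) (simp add: h_def algebra_simps)
      finally show ?thesis .
    qed
    ultimately show "first_order F (\<lambda>m. K * ((real (N m) / (h * real m)) ^ P * G m)) 1 A"
      using uK by (simp add: mult.commute)
  qed
  then have R: "R \<in> O[at_top_int_mult c](\<lambda>m. 1 / real m ^ 2)"
    by (simp add: first_order_def R_def[abs_def] F_def)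
  have "\<forall>\<^sub>F m in at_top_int_mult c. E m = (h * real m) ^ P / K * (1 + A / real m + R m)"
    using ev unfolding F_def
    by eventually_elim (use h K in \<open>simp add: R_def\<close>)
  then show ?thesis
    using R unfolding E_def P_def K_def q_def h_def A_def
    by (intro exI[of _ R])
      (simp add: prod.atLeast1_atMost_eq sum.atLeast1_atMost_eq)
qed

end
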